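(* For all positive integers $m,q$, the transformation $T_{\beta_{q,m},\alpha}$ has matching for Lebesgue almost every $\alpha\in[0,1)$.
   Context: For real $\beta\ge 1$ and $\alpha\in[0,1)$, let $T_{\beta,\alpha}:[0,1]\to[0,1]$, $T_{\beta,\alpha}(x)=\beta x+\alpha-\lfloor\beta x+\alpha\rfloor$, where $\lfloor\cdot\rfloor$ is the integer part; $T^k_{\beta,\alpha}$ denotes the $k$-th iterate. The map $T_{\beta,\alpha}$ has matching if there is a positive integer $k$ with $T_{\beta,\alpha}^k(0)=T_{\beta,\alpha}^k(1)$. For positive integers $q,m$, the $(q,m)$-multinacci number $\beta_{q,m}$ is the unique real root in $[q,q+1)$ of $x^m=q x^{m-1}+q x^{m-2}+\cdots+q$ (for $m\ge 2$ it lies in $(q,q+1)$, and $\beta_{q,1}=q$). *)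

theory Defs
  imports "HOL-Analysis.Analysis"
begin

text \<open>The map is total on the reals; it sends everything into \<open>[0, 1)\<close>, so iterates of points of
  the interval \<open>[0, 1]\<close> stay there. In particular the value at \<open>1\<close> is the one given
  by the formula, not a left limit.\<close>

definition T :: "real \<Rightarrow> real \<Rightarrow> real \<Rightarrow> real" where
  "T \<beta> \<alpha> x = \<beta> * x + \<alpha> - of_int \<lfloor>\<beta> * x + \<alpha>\<rfloor>"

definition has_matching :: "real \<Rightarrow> real \<Rightarrow> bool" where
  "has_matching \<beta> \<alpha> \<longleftrightarrow> (\<exists>k\<ge>1. (T \<beta> \<alpha> ^^ k) 0 = (T \<beta> \<alpha> ^^ k) 1)"

definition is_multinacci :: "nat \<Rightarrow> nat \<Rightarrow> real \<Rightarrow> bool" where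
  "is_multinacci q m x \<longleftrightarrow>
     x \<in> {real q..<real q + 1} \<and> x ^ m = (\<Sum>i<m. real q * x ^ i)"

definition multinacci :: "nat \<Rightarrow> nat \<Rightarrow> real" where
  "multinacci q m = (THE x. is_multinacci q m x)"

lemma T_in_unit_interval: "T \<beta> \<alpha> x \<in> {0..<1}"
  unfolding T_def by (simp add: frac_def[symmetric] frac_lt_1)

lemma multinacci_root_unique:
  assumes "q \<ge> 1" "m \<ge> 1" "is_multinacci q m x" "is_multinacci q m y"
  shows "x = y"
proof -
  have aux: False if xy: "is_multinacci q m u" "is_multinacci q m v" "u < v" for u v
  proof -
    have pos: "u > 0" "v > 0" using xy assms(1) by (auto simp: is_multinacci_def)
    have eu: "u ^ m = (\<Sum>i<m. real q * u ^ i)" and ev: "v ^ m = (\<Sum>i<m. real q * v ^ i)"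
      using xy by (auto simp: is_multinacci_def)
    have le: "u ^ m * v ^ i \<le> v ^ m * u ^ i" if "i < m" for i
    proof -
      have "u ^ (m - i) \<le> v ^ (m - i)" using pos xy(3) by (intro power_mono) auto
      hence "u ^ (m - i) * (u ^ i * v ^ i) \<le> v ^ (m - i) * (u ^ i * v ^ i)"
        using pos by (intro mult_right_mono) auto
      moreover have "u ^ m = u ^ (m - i) * u ^ i" "v ^ m = v ^ (m - i) * v ^ i"
        using that by (simp_all flip: power_add)
      ultimately show ?thesis by (simp add: mult_ac)
    qed
    have lt0: "u ^ m * v ^ 0 < v ^ m * u ^ 0"
      using pos xy(3) assms(2) by (simp add: power_strict_mono)
    have "(\<Sum>i<m. real q * (u ^ m * v ^ i)) < (\<Sum>i<m. real q * (v ^ m * u ^ i))"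
    proof (rule sum_strict_mono_ex1)
      show "\<forall>i\<in>{..<m}. real q * (u ^ m * v ^ i) \<le> real q * (v ^ m * u ^ i)"
        using le by (intro ballI mult_left_mono) auto
      show "\<exists>i\<in>{..<m}. real q * (u ^ m * v ^ i) < real q * (v ^ m * u ^ i)"
        using lt0 assms by (intro bexI[of _ 0] mult_strict_left_mono) auto
    qed simp
    moreover have "(\<Sum>i<m. real q * (u ^ m * v ^ i)) = u ^ m * v ^ m"
      using arg_cong[OF ev, of "\<lambda>t. u ^ m * t"] by (simp add: sum_distrib_left mult_ac)
    moreover have "(\<Sum>i<m. real q * (v ^ m * u ^ i)) = v ^ m * u ^ m"
      using arg_cong[OF eu, of "\<lambda>t. v ^ m * t"] by (simp add: sum_distrib_left mult_ac)
    ultimately show False by (simp add: mult_ac)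
  qed
  from aux[OF assms(3,4)] aux[OF assms(4,3)] show ?thesis by (metis linorder_neqE)
qed

lemma multinacci_root_exists:
  assumes "q \<ge> 1" "m \<ge> 1"
  shows "\<exists>x. is_multinacci q m x"
proof -
  define f where "f x = x ^ m - (\<Sum>i<m. real q * x ^ i)" for x :: real
  have "real q * real q ^ (m - 1) \<le> (\<Sum>i<m. real q * real q ^ i)"
    using assms by (intro member_le_sum) auto
  moreover have "real q * real q ^ (m - 1) = real q ^ m"
    using assms by (simp flip: power_Suc)
  ultimately have f0: "f (real q) \<le> 0" unfolding f_def by simp
  have "(\<Sum>i<m. real q * (real q + 1) ^ i) = (real q + 1) ^ m - 1"
    using power_diff_1_eq[of "real q + 1" m] by (simp add: sum_distrib_left)
  hence f1: "f (real q + 1) = 1" unfolding f_def by simp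
  have "continuous_on {real q..real q + 1} f" unfolding f_def by (intro continuous_intros)
  then obtain x where x: "real q \<le> x" "x \<le> real q + 1" "f x = 0"
    using IVT'[of f "real q" 0 "real q + 1"] f0 f1 by auto
  hence "x \<noteq> real q + 1" using f1 by auto
  with x have "is_multinacci q m x" unfolding is_multinacci_def f_def by auto
  thus ?thesis ..
qed

lemma is_multinacci_multinacci:
  assumes "q \<ge> 1" "m \<ge> 1"
  shows "is_multinacci q m (multinacci q m)"
  unfolding multinacci_def
  using multinacci_root_exists[OF assms] multinacci_root_unique[OF assms] by (blast intro: theI)

end

theory Submission imports Defs begin

text \<open>
  Let \<open>\<beta>\<close> be the multinacci number, \<open>m \<ge> 2\<close>, and \<open>eps = q + 1 - \<beta>\<close>. The defining equation says
  \<open>eps * \<beta> ^ m = q\<close>, so the numbers \<open>lam i = eps * \<beta> ^ i\<close> with \<open>i < m\<close> are positive weights of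
  sum \<open>1\<close>. They encode the distance of the two orbits: if \<open>l = T ^ k 1\<close> and \<open>r = T ^ k 0\<close>, then
  \<open>r\<close> is congruent to \<open>l + (\<Sum>i<m. lam i * w i)\<close> modulo \<open>1\<close>, where \<open>w\<close> is a window of \<open>m\<close> bits, and one
  step of the map shifts the window and inserts the bit that tells whether the arc from \<open>l\<close> of that
  length reaches \<open>1\<close> (\<open>orbit_pair\<close>). If the \<open>m\<close> bits of a window agree, the arc has length
  \<open>0\<close> or \<open>1\<close> and the orbits have met. Matching thus follows once \<open>m\<close> consecutive bits are equal, and
  the bits depend only on \<open>l\<close> and on the previous window.

  Synchronisation. For \<open>eps < \<alpha> < q / \<beta>\<close> the map has a fixed point \<open>z > \<alpha>\<close>, and \<open>z - q / \<beta>\<close> is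
  another preimage of \<open>z\<close>. Consider an orbit that starts close to \<open>z\<close>, drifts away from it, passes through
  \<open>z - q / \<beta>\<close> and so returns to \<open>z\<close>. While it is close to \<open>z\<close>, bits equal to one are merely rotated and
  new ones may appear until the window is stable under rotation; during the excursion ones can only be
  lost, and by choosing the length of the stay near \<open>z\<close> a chosen removable one is lost in the last step
  (\<open>remove_one\<close>). A stable window that is not constant always has a removable one
  (\<open>removable\<close>). Hence finitely many such loops turn any window into a constant one, and
  concatenating them one finds a single piece of orbit that does so for all windows simultaneously
  (\<open>sync_list\<close>). For \<open>\<alpha>\<close> outside a countable set this is stable under perturbation of \<open>l\<close> and \<open>\<alpha>\<close>.
  Because \<open>T\<close> expands, points from which it happens are dense: the images of a longest gap between them
  would include a longer gap or one that contains \<open>z\<close> (\<open>no_gap\<close>).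

  Measure. As a function of \<open>\<alpha>\<close>, the point \<open>T ^ k 1\<close> is piecewise affine with slope \<open>1 + \<beta> + \<dots> + \<beta> ^ (k - 1)\<close>,
  and the breakpoints created at step \<open>k\<close> are separated by a constant multiple of the inverse slope, since
  small numbers of the form \<open>\<Sum> n i * \<beta> ^ i\<close> with bounded integers \<open>n i\<close> cannot accumulate at \<open>0\<close>
  (\<open>separation\<close>). There are therefore so few breakpoints that almost every \<open>\<alpha>\<close> has, for some
  \<open>\<rho> > 0\<close> and infinitely many \<open>k\<close>, a neighbourhood that \<open>T ^ k 1\<close> maps affinely onto an interval of
  radius \<open>\<rho>\<close>. A fixed proportion of this interval synchronises, so the set without matching is porous at
  almost all of its points, and it is a null set by Vitali's covering theorem.

  The remaining parameters. The reflection \<open>x \<mapsto> 1 - x\<close> exchanges \<open>\<alpha>\<close> with \<open>1 + eps - \<alpha>\<close> up to a countable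
  set. For \<open>\<alpha> < eps\<close>, and for \<open>q = 1\<close> in the central interval between \<open>1 / \<beta>\<close> and \<open>1 + eps - 1 / \<beta>\<close>,
  the two orbits can be computed for \<open>m\<close> steps. In the central interval there are no loops as above: the
  fixed point lies between \<open>T 1\<close> and \<open>T 0\<close> and has no preimage but itself.
\<close>

section \<open>Windows encode the distance of the two orbits\<close>

locale multinacci_base =
  fixes q m :: nat and \<beta> :: real
  assumes m2: "2 \<le> m" and q1: "1 \<le> q" and root: "is_multinacci q m \<beta>"
begin

text \<open>
  On the circle, \<open>T\<close> is discontinuous only at \<open>0\<close>, where its one-sided limits are \<open>\<alpha> - eps\<close> from the
  left and \<open>\<alpha>\<close> from the right; \<open>eps\<close> is the size of this jump.
\<close>

definition eps :: real where "eps = real q + 1 - \<beta>"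

definition lam :: "nat \<Rightarrow> real" where "lam i = eps * \<beta> ^ i"

lemma beta_gt_q: "real q < \<beta>"
proof -
  have b: "real q \<le> \<beta>" "\<beta> ^ m = (\<Sum>i<m. real q * \<beta> ^ i)"
    using root by (auto simp: is_multinacci_def)
  have pos: "0 < \<beta>" using b q1 by linarith
  obtain k where k: "m = Suc (Suc k)" using m2 by (intro that[of "m - 2"]) simp
  have "(\<Sum>i<m. real q * \<beta> ^ i) = (\<Sum>i<Suc k. real q * \<beta> ^ i) + real q * \<beta> ^ Suc k"
    using k by simp
  moreover have "(\<Sum>i<Suc k. real q * \<beta> ^ i) > 0"
    using pos q1 by (intro sum_pos) auto
  ultimately have "real q * \<beta> ^ Suc k < \<beta> * \<beta> ^ Suc k" using b(2) k by simp
  then show ?thesis using pos by (simp add: mult_less_cancel_right)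
qed

lemma beta_gt_1: "1 < \<beta>" using beta_gt_q q1 by linarith
lemma beta_pos: "0 < \<beta>" using beta_gt_1 by linarith
lemma beta_lt: "\<beta> < real q + 1" using root by (auto simp: is_multinacci_def)

lemma eps_pos: "0 < eps"
  using beta_lt by (simp add: eps_def)

lemma eps_power: "eps * \<beta> ^ m = real q"
proof -
  have "\<beta> ^ m = real q * (\<Sum>i<m. \<beta> ^ i)"
    using root by (simp add: is_multinacci_def sum_distrib_left)
  then have "(\<beta> - 1) * \<beta> ^ m = real q * ((\<beta> - 1) * (\<Sum>i<m. \<beta> ^ i))" by simp
  also have "\<dots> = real q * (\<beta> ^ m - 1)" by (simp add: power_diff_1_eq)
  finally show ?thesis by (simp add: eps_def algebra_simps)
qed

lemma lam_pos: "0 < lam i" using eps_pos beta_pos by (simp add: lam_def)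
lemma lam_Suc: "lam (Suc i) = \<beta> * lam i" by (simp add: lam_def)
lemma lam_0: "lam 0 = eps" by (simp add: lam_def)

lemma beta_lam_last: "\<beta> * lam (m - 1) = real q"
proof -
  have "\<beta> ^ m = \<beta> * \<beta> ^ (m - 1)" using m2 by (simp flip: power_Suc)
  then show ?thesis using eps_power by (simp add: lam_def mult_ac)
qed

lemma lam_last: "lam (m - 1) = real q / \<beta>"
  using beta_lam_last beta_pos by (simp add: field_simps)

lemma sum_lam: "(\<Sum>i<m. lam i) = 1"
proof -
  have "\<beta> ^ m = real q * (\<Sum>i<m. \<beta> ^ i)"
    using root by (simp add: is_multinacci_def sum_distrib_left)
  then have "real q * (\<Sum>i<m. lam i) = eps * \<beta> ^ m"
    by (simp add: lam_def sum_distrib_left mult_ac)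
  then show ?thesis using eps_power q1 by simp
qed

text \<open>
  Windows are infinite bit sequences, latest bit first; only the first \<open>m\<close> bits matter. Keeping the
  whole history makes appending a bit the plain operation \<open>case_nat\<close>.
\<close>

definition ell :: "(nat \<Rightarrow> bool) \<Rightarrow> real" where
  "ell w = (\<Sum>i<m. lam i * of_bool (w i))"

definition const_window :: "(nat \<Rightarrow> bool) \<Rightarrow> bool" where
  "const_window w \<longleftrightarrow> (\<forall>i<m. w i) \<or> (\<forall>i<m. \<not> w i)"

lemma ell_nonneg: "0 \<le> ell w"
  unfolding ell_def using lam_pos by (intro sum_nonneg) (simp add: less_imp_le)

lemma ell_le_1: "ell w \<le> 1"
proof -
  have "ell w \<le> (\<Sum>i<m. lam i)"
    unfolding ell_def using lam_pos by (intro sum_mono) (simp add: less_imp_le)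
  then show ?thesis by (simp add: sum_lam)
qed

lemma ell_const:
  assumes "const_window w" shows "ell w = of_bool (w 0)"
  using assms sum_lam m2 by (auto simp: ell_def const_window_def simp del: sum_mult_of_bool_eq)

lemma ell_cong: "(\<And>i. i < m \<Longrightarrow> w i = w' i) \<Longrightarrow> ell w = ell w'"
  by (simp add: ell_def)

lemma finite_range_ell: "finite (range ell)"
proof -
  have "range ell \<subseteq> (\<lambda>A. \<Sum>i<m. lam i * of_bool (i \<in> A)) ` Pow {..<m}"
  proof
    fix x assume "x \<in> range ell"
    then obtain w where "x = ell w" by auto
    then have "x = (\<Sum>i<m. lam i * of_bool (i \<in> {i. i < m \<and> w i}))" by (simp add: ell_def)
    then show "x \<in> (\<lambda>A. \<Sum>i<m. lam i * of_bool (i \<in> A)) ` Pow {..<m}" by blast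
  qed
  then show ?thesis by (rule finite_subset) simp
qed

text \<open>
  The drop of \<open>q\<close> for a bit that leaves the window is a number of full turns around the circle. It comes
  out as an integer because \<open>\<beta> * lam (m - 1) = q\<close>, which is the equation for \<open>\<beta>\<close>.
\<close>

lemma ell_push:
  "ell (case_nat b w) = \<beta> * ell w + eps * of_bool b - real q * of_bool (w (m - 1))"
proof -
  obtain k where k: "m = Suc k" using m2 by (cases m) auto
  have k2: "{..<m} = {..<Suc k}" by (simp add: k)
  have "ell (case_nat b w) = lam 0 * of_bool b + (\<Sum>i<k. lam (Suc i) * of_bool (w i))"
    by (simp only: ell_def k2 sum.lessThan_Suc_shift) simp
  moreover have "\<beta> * ell w = (\<Sum>i<k. lam (Suc i) * of_bool (w i)) + \<beta> * lam k * of_bool (w k)"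
    by (simp only: ell_def k2 sum.lessThan_Suc) (simp add: sum_distrib_left lam_Suc distrib_left mult.assoc
        del: sum_mult_of_bool_eq)
  moreover have "\<beta> * lam k = real q" using beta_lam_last k by simp
  moreover have "m - 1 = k" using k by simp
  ultimately show ?thesis unfolding lam_0 by (simp add: distrib_right)
qed

abbreviation hit :: "real \<Rightarrow> (nat \<Rightarrow> bool) \<Rightarrow> bool" where
  "hit l w \<equiv> 1 \<le> l + ell w"

text \<open>
  A state consists of the left end \<open>l\<close> of an arc and the window that gives its length; \<open>hit\<close> says that the
  arc reaches \<open>1\<close>, that is, the discontinuity of \<open>T\<close> on the circle.
\<close>

definition step :: "real \<Rightarrow> real \<times> (nat \<Rightarrow> bool) \<Rightarrow> real \<times> (nat \<Rightarrow> bool)" where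
  "step \<alpha> s = (T \<beta> \<alpha> (fst s), case_nat (hit (fst s) (snd s)) (snd s))"

abbreviation win :: "real \<Rightarrow> nat \<Rightarrow> real \<Rightarrow> (nat \<Rightarrow> bool) \<Rightarrow> nat \<Rightarrow> bool" where
  "win \<alpha> n l w \<equiv> snd ((step \<alpha> ^^ n) (l, w))"

lemma fst_steps: "fst ((step \<alpha> ^^ n) s) = (T \<beta> \<alpha> ^^ n) (fst s)"
  by (induction n) (auto simp: step_def)

lemma win_Suc: "win \<alpha> (Suc n) l w = case_nat (hit ((T \<beta> \<alpha> ^^ n) l) (win \<alpha> n l w)) (win \<alpha> n l w)"
  by (simp add: step_def fst_steps)

lemma steps_eq: "(step \<alpha> ^^ n) (l, w) = ((T \<beta> \<alpha> ^^ n) l, win \<alpha> n l w)"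
  by (simp add: prod_eq_iff fst_steps)

lemma win_add: "win \<alpha> (n + k) l w = win \<alpha> n ((T \<beta> \<alpha> ^^ k) l) (win \<alpha> k l w)"
  unfolding funpow_add comp_apply by (subst steps_eq[where \<alpha> = \<alpha> and n = k and l = l and w = w]) (rule refl)

lemma T_frac: "T \<beta> \<alpha> x = frac (\<beta> * x + \<alpha>)"
  by (simp add: T_def frac_def)

lemma frac_eq_if_diff_int: "x - y \<in> \<int> \<Longrightarrow> frac x = frac (y::real)"
proof -
  assume "x - y \<in> \<int>"
  then obtain n where "x - y = of_int n" by (auto elim: Ints_cases)
  then have "x = y + of_int n" by simp
  then show ?thesis by (simp add: frac_def)
qed

lemma floor_hit:
  assumes "0 \<le> l" "l < 1" shows "\<lfloor>l + ell w\<rfloor> = of_bool (hit l w)"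
proof (cases "hit l w")
  case True
  then show ?thesis using assms ell_le_1[of w] by (simp add: floor_eq_iff)
next
  case False
  then show ?thesis using assms ell_nonneg[of w] by (simp add: floor_eq_iff)
qed

text \<open>
  Two points at distance \<open>ell w\<close> are mapped to points at distance given by the shifted window: each
  passage through the discontinuity adds \<open>eps\<close>, and whole turns disappear modulo \<open>1\<close>.
\<close>

lemma T_pair:
  assumes "0 \<le> l" "l < 1"
  shows "T \<beta> \<alpha> (frac (l + ell w)) = frac (T \<beta> \<alpha> l + ell (case_nat (hit l w) w))"
proof -
  define b where "b = hit l w"
  have f: "frac (l + ell w) = l + ell w - of_bool b"
    using floor_hit[OF assms] by (simp add: frac_def b_def)
  have "(\<beta> * frac (l + ell w) + \<alpha>) - (T \<beta> \<alpha> l + ell (case_nat b w))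
      = of_int (\<lfloor>\<beta> * l + \<alpha>\<rfloor> + int q * of_bool (w (m - 1)) - (int q + 1) * of_bool b)"
    by (simp add: f T_def ell_push eps_def algebra_simps)
  then show ?thesis unfolding T_frac[of _ "frac (l + ell w)"] b_def
    by (intro frac_eq_if_diff_int) simp
qed

text \<open>
  After one step the orbits of \<open>1\<close> and \<open>0\<close> are the two one-sided images of the discontinuity, at distance
  \<open>eps = lam 0\<close>.
\<close>

definition first_window :: "nat \<Rightarrow> bool" where "first_window i \<longleftrightarrow> i = 0"

lemma T_in: "0 \<le> T \<beta> \<alpha> x" "T \<beta> \<alpha> x < 1"
  using T_in_unit_interval[of \<beta> \<alpha> x] by auto

lemma orbit_pair:
  "(T \<beta> \<alpha> ^^ Suc n) 0 = frac ((T \<beta> \<alpha> ^^ Suc n) 1 + ell (win \<alpha> n (T \<beta> \<alpha> 1) first_window))"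
proof (induction n)
  case 0
  have "ell first_window = (\<Sum>i<m. if i = 0 then lam 0 else 0)"
    unfolding ell_def first_window_def by (intro sum.cong) auto
  then have "ell first_window = eps" using m2 by (simp add: lam_0)
  then have "\<alpha> - (T \<beta> \<alpha> 1 + ell first_window) = of_int (\<lfloor>\<beta> + \<alpha>\<rfloor> - int q - 1)"
    by (simp add: eps_def T_def)
  then have "frac \<alpha> = frac (T \<beta> \<alpha> 1 + ell first_window)"
    by (intro frac_eq_if_diff_int) (simp only: Ints_of_int)
  then show ?case by (simp add: T_frac)
next
  case (Suc n)
  have eq: "(T \<beta> \<alpha> ^^ n) (T \<beta> \<alpha> 1) = (T \<beta> \<alpha> ^^ Suc n) 1" by (simp add: funpow_swap1)
  have in1: "0 \<le> (T \<beta> \<alpha> ^^ Suc n) 1" "(T \<beta> \<alpha> ^^ Suc n) 1 < 1" using T_in by auto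
  have "(T \<beta> \<alpha> ^^ Suc (Suc n)) 0 = T \<beta> \<alpha> ((T \<beta> \<alpha> ^^ Suc n) 0)" by simp
  also have "\<dots> = T \<beta> \<alpha> (frac ((T \<beta> \<alpha> ^^ Suc n) 1 + ell (win \<alpha> n (T \<beta> \<alpha> 1) first_window)))"
    by (simp only: Suc)
  also have "\<dots> = frac (T \<beta> \<alpha> ((T \<beta> \<alpha> ^^ Suc n) 1) + ell (win \<alpha> (Suc n) (T \<beta> \<alpha> 1) first_window))"
    unfolding win_Suc eq by (rule T_pair[OF in1])
  finally show ?case by simp
qed

lemma matching_if_const:
  assumes "const_window (win \<alpha> n (T \<beta> \<alpha> 1) first_window)"
  shows "has_matching \<beta> \<alpha>"
proof -
  have "(T \<beta> \<alpha> ^^ Suc n) 0 = frac ((T \<beta> \<alpha> ^^ Suc n) 1 + of_bool (win \<alpha> n (T \<beta> \<alpha> 1) first_window 0))"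
    unfolding orbit_pair ell_const[OF assms] ..
  also have "\<dots> = frac ((T \<beta> \<alpha> ^^ Suc n) 1)"
    by (rule frac_eq_if_diff_int) simp
  also have "\<dots> = (T \<beta> \<alpha> ^^ Suc n) 1" using T_in by (simp add: frac_eq)
  finally have e: "(T \<beta> \<alpha> ^^ Suc n) 0 = (T \<beta> \<alpha> ^^ Suc n) 1" .
  show ?thesis unfolding has_matching_def by (rule exI[of _ "Suc n"], rule conjI, simp, rule e)
qed

lemma const_step:
  assumes "0 < l" "l < 1" "const_window w"
  shows "const_window (case_nat (hit l w) w)"
proof -
  have "ell w = of_bool (w 0)" by (rule ell_const[OF assms(3)])
  then have h: "hit l w = w 0" using assms(1,2) by simp
  show ?thesis using assms(3) m2 unfolding h const_window_def
    by (auto split: nat.split)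
qed

end

section \<open>Loops near the fixed point as operations on windows\<close>

context multinacci_base
begin

text \<open>
  Read cyclically, a window describes what happens if every new bit repeats the one that is dropped.
  When the bit at position \<open>p\<close> is about to be dropped, the other \<open>m - 1\<close> bits contribute
  \<open>rest_weight p w\<close> to the length of the arc.
\<close>

definition rest_weight :: "nat \<Rightarrow> (nat \<Rightarrow> bool) \<Rightarrow> real" where
  "rest_weight p w = (\<Sum>i<m - 1. lam i * of_bool (w ((p + 1 + i) mod m)))"

definition ones :: "(nat \<Rightarrow> bool) \<Rightarrow> nat" where
  "ones w = (\<Sum>i<m. of_bool (w i))"

text \<open>
  For the threshold \<open>c\<close> the cyclic rotation of such a window never creates a new one.
\<close>

definition persistent :: "real \<Rightarrow> (nat \<Rightarrow> bool) \<Rightarrow> bool" where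
  "persistent c w \<longleftrightarrow> (\<forall>p<m. \<not> w p \<longrightarrow> rest_weight p w < c)"

definition threshold_push :: "real \<Rightarrow> (nat \<Rightarrow> bool) \<Rightarrow> nat \<Rightarrow> bool" where
  "threshold_push \<tau> w = case_nat (\<tau> \<le> ell w) w"

lemma ell_eq_rest_weight: "ell w = rest_weight (m - 1) w + lam (m - 1) * of_bool (w (m - 1))"
proof -
  have "{..<m} = {..<Suc (m - 1)}" using m2 by auto
  then have "ell w = (\<Sum>i<Suc (m - 1). lam i * of_bool (w i))" by (simp only: ell_def)
  also have "\<dots> = (\<Sum>i<m - 1. lam i * of_bool (w i)) + lam (m - 1) * of_bool (w (m - 1))"
    by (rule sum.lessThan_Suc)
  also have "(\<Sum>i<m - 1. lam i * of_bool (w i)) = rest_weight (m - 1) w"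
    unfolding rest_weight_def using m2 by (intro sum.cong) auto
  finally show ?thesis .
qed

lemma push_mod_le:
  assumes "b \<longrightarrow> w (m - 1)" "case_nat b w (Suc k mod m)" shows "w (k mod m)"
proof (cases "Suc (k mod m) = m")
  case True
  then have "k mod m = m - 1" by simp
  then show ?thesis using assms True by (simp add: mod_Suc)
qed (use assms in \<open>simp add: mod_Suc\<close>)

lemma push_mod_ge:
  assumes "w (m - 1) \<longrightarrow> b" "w (k mod m)" shows "case_nat b w (Suc k mod m)"
proof (cases "Suc (k mod m) = m")
  case True
  then have "k mod m = m - 1" by simp
  then show ?thesis using assms True by (simp add: mod_Suc)
qed (use assms in \<open>simp add: mod_Suc\<close>)

lemma rest_weight_push_le:
  assumes "b \<longrightarrow> w (m - 1)"
  shows "rest_weight (Suc p mod m) (case_nat b w) \<le> rest_weight (p mod m) w"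
  unfolding rest_weight_def
proof (rule sum_mono)
  fix i
  have 1: "(Suc p mod m + 1 + i) mod m = Suc (p + 1 + i) mod m"
    using mod_add_left_eq[of "Suc p" m "1 + i"] by simp
  have 2: "(p mod m + 1 + i) mod m = (p + 1 + i) mod m"
    using mod_add_left_eq[of p m "1 + i"] by simp
  have "of_bool (case_nat b w (Suc (p + 1 + i) mod m)) \<le> (of_bool (w ((p + 1 + i) mod m)) :: real)"
    using push_mod_le[of b w "p + 1 + i"] assms by (simp only: of_bool_less_eq_iff) blast
  then show "lam i * of_bool (case_nat b w ((Suc p mod m + 1 + i) mod m))
      \<le> lam i * of_bool (w ((p mod m + 1 + i) mod m))"
    unfolding 1 2 using lam_pos[of i] by (intro mult_left_mono) auto
qed

lemma rest_weight_push_ge: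
  assumes "w (m - 1) \<longrightarrow> b"
  shows "rest_weight (p mod m) w \<le> rest_weight (Suc p mod m) (case_nat b w)"
  unfolding rest_weight_def
proof (rule sum_mono)
  fix i
  have 1: "(Suc p mod m + 1 + i) mod m = Suc (p + 1 + i) mod m"
    using mod_add_left_eq[of "Suc p" m "1 + i"] by simp
  have 2: "(p mod m + 1 + i) mod m = (p + 1 + i) mod m"
    using mod_add_left_eq[of p m "1 + i"] by simp
  have "(of_bool (w ((p + 1 + i) mod m)) :: real) \<le> of_bool (case_nat b w (Suc (p + 1 + i) mod m))"
    using push_mod_ge[of w b "p + 1 + i"] assms by (simp only: of_bool_less_eq_iff) blast
  then show "lam i * of_bool (w ((p mod m + 1 + i) mod m))
      \<le> lam i * of_bool (case_nat b w ((Suc p mod m + 1 + i) mod m))"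
    unfolding 1 2 using lam_pos[of i] by (intro mult_left_mono) auto
qed

lemma rest_weight_push_0: "rest_weight 0 (case_nat b w) = rest_weight (m - 1) w"
  unfolding rest_weight_def using m2 by (intro sum.cong) auto

lemma ones_push: "ones (case_nat b w) + of_bool (w (m - 1)) = ones w + of_bool b"
proof -
  have e: "{..<m} = {..<Suc (m - 1)}" using m2 by auto
  have "ones (case_nat b w) = of_bool b + (\<Sum>i<m - 1. of_bool (w i))"
    unfolding ones_def e by (subst sum.lessThan_Suc_shift) simp
  moreover have "ones w = (\<Sum>i<m - 1. of_bool (w i)) + of_bool (w (m - 1))"
    unfolding ones_def e by (rule sum.lessThan_Suc)
  ultimately show ?thesis by simp
qed

lemma ones_le: "ones w \<le> m"
proof -
  have "ones w \<le> (\<Sum>i<m. 1)" unfolding ones_def by (intro sum_mono) simp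
  then show ?thesis by simp
qed

text \<open>
  A zero cannot turn into a one since its rest weight stays below \<open>c \<le> \<tau>\<close>. If a one is lost, its
  length was below \<open>\<tau> \<le> c + lam (m - 1)\<close>, so its rest weight was below \<open>c\<close> and the new zero is
  persistent too.
\<close>

lemma persistent_step:
  assumes "persistent c w" "c \<le> \<tau>" "\<tau> \<le> c + lam (m - 1)"
  shows "persistent c (threshold_push \<tau> w)" and "\<tau> \<le> ell w \<longrightarrow> w (m - 1)"
proof -
  have m1: "m - 1 < m" using m2 by simp
  show b: "\<tau> \<le> ell w \<longrightarrow> w (m - 1)"
  proof (rule ccontr)
    assume "\<not> ?thesis"
    then have "\<tau> \<le> ell w" "\<not> w (m - 1)" by auto
    then show False using assms m1 ell_eq_rest_weight[of w] by (auto simp: persistent_def)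
  qed
  show "persistent c (threshold_push \<tau> w)"
    unfolding persistent_def
  proof (intro allI impI)
    fix p assume p: "p < m" "\<not> threshold_push \<tau> w p"
    show "rest_weight p (threshold_push \<tau> w) < c"
    proof (cases p)
      case 0
      then have "ell w < \<tau>" using p by (simp add: threshold_push_def not_le)
      then have "rest_weight (m - 1) w < c"
        using assms m1 ell_eq_rest_weight[of w] by (cases "w (m - 1)") (auto simp: persistent_def)
      then show ?thesis by (simp add: 0 threshold_push_def rest_weight_push_0)
    next
      case (Suc k)
      have "rest_weight p (threshold_push \<tau> w) \<le> rest_weight k w"
        using rest_weight_push_le[of "\<tau> \<le> ell w" w k, OF b] p Suc by (simp add: threshold_push_def)
      moreover have "rest_weight k w < c" using assms(1) p Suc by (simp add: persistent_def threshold_push_def)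
      ultimately show ?thesis by simp
    qed
  qed
qed

lemma threshold_keeps_ones:
  assumes "c \<le> lam (m - 1)"
  shows "w (m - 1) \<longrightarrow> c \<le> ell w"
proof
  assume "w (m - 1)"
  moreover have "0 \<le> rest_weight (m - 1) w"
    unfolding rest_weight_def using lam_pos by (intro sum_nonneg) (simp add: less_imp_le)
  ultimately show "c \<le> ell w" using ell_eq_rest_weight[of w] assms by simp
qed

lemma ones_threshold_mono:
  assumes "c \<le> lam (m - 1)" shows "ones w \<le> ones (threshold_push c w)"
  using ones_push[of "c \<le> ell w" w] threshold_keeps_ones[OF assms, of w]
  by (cases "w (m - 1)") (auto simp: threshold_push_def)

text \<open>
  A zero that violates persistence becomes a one at the latest when rotation has brought it to the end of the
  window, because ones are never lost at the threshold \<open>c\<close>.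
\<close>

lemma ones_threshold_increase:
  assumes "c \<le> lam (m - 1)" "p < m" "\<not> w p" "c \<le> rest_weight p w"
  shows "\<exists>t. ones w < ones ((threshold_push c ^^ t) w)"
  using assms(2-)
proof (induction "m - p" arbitrary: p w)
  case 0 then show ?case by simp
next
  case (Suc k)
  show ?case
  proof (cases "p = m - 1")
    case True
    have "c \<le> ell w" using Suc.prems True ell_eq_rest_weight[of w] by simp
    then have "ones w < ones (threshold_push c w)"
      using ones_push[of "c \<le> ell w" w] Suc.prems True by (simp add: threshold_push_def)
    then show ?thesis by (intro exI[of _ 1]) simp
  next
    case False
    then have p: "Suc p < m" using Suc.prems by simp
    have "rest_weight p w \<le> rest_weight (Suc p) (threshold_push c w)"
      using rest_weight_push_ge[of w "c \<le> ell w" p] threshold_keeps_ones[OF assms(1)] p by (simp add: threshold_push_def)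
    moreover have "\<not> threshold_push c w (Suc p)" using Suc.prems by (simp add: threshold_push_def)
    moreover have "k = m - Suc p" using Suc.hyps(2) by simp
    ultimately obtain t where "ones (threshold_push c w) < ones ((threshold_push c ^^ t) (threshold_push c w))"
      using Suc.hyps(1)[of "Suc p" "threshold_push c w"] p Suc.prems by fastforce
    then have "ones w < ones ((threshold_push c ^^ Suc t) w)"
      using ones_threshold_mono[OF assms(1), of w] by (simp add: funpow_swap1)
    then show ?thesis by blast
  qed
qed

text \<open>
  The number of ones is bounded by \<open>m\<close> and increases as long as the window is not persistent.
\<close>

lemma reach_persistent:
  assumes "c \<le> lam (m - 1)"
  shows "\<exists>t. persistent c ((threshold_push c ^^ t) w)"
proof (induction "m - ones w" arbitrary: w rule: less_induct)
  case less
  show ?case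
  proof (cases "persistent c w")
    case True then show ?thesis by (intro exI[of _ 0]) simp
  next
    case False
    then obtain p where "p < m" "\<not> w p" "c \<le> rest_weight p w" by (auto simp: persistent_def not_less)
    then obtain t where t: "ones w < ones ((threshold_push c ^^ t) w)"
      using ones_threshold_increase[OF assms] by blast
    then have "m - ones ((threshold_push c ^^ t) w) < m - ones w" using ones_le[of "(threshold_push c ^^ t) w"] by simp
    then obtain s where "persistent c ((threshold_push c ^^ s) ((threshold_push c ^^ t) w))" using less by blast
    then have "persistent c ((threshold_push c ^^ (s + t)) w)" by (simp add: funpow_add)
    then show ?thesis by blast
  qed
qed

lemma rotation_const:
  assumes "\<And>p. p < m \<Longrightarrow> w p \<Longrightarrow> w (Suc p mod m)"
  shows "const_window w"
proof (cases "\<exists>p<m. w p")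
  case True
  then obtain p where p: "p < m" "w p" by blast
  have w: "w ((p + k) mod m)" for k
  proof (induction k)
    case (Suc k)
    then show ?case using assms[of "(p + k) mod m"] m2 by (simp add: mod_Suc_eq)
  qed (use p in simp)
  have "w i" if "i < m" for i
  proof -
    have "(p + (m - p + i)) mod m = i" using p that by simp
    then show ?thesis using w[of "m - p + i"] by simp
  qed
  then show ?thesis by (simp add: const_window_def)
qed (auto simp: const_window_def)

text \<open>
  At a cyclic transition from a zero at position \<open>p + 1\<close> to a one at position \<open>p\<close>, the rest weight of the one is
  \<open>\<beta>\<close> times that of the zero, minus \<open>lam (m - 1)\<close>. The zero has rest weight below \<open>c\<close>, and
  \<open>\<beta> * c - lam (m - 1) \<le> c\<close>.
\<close>

lemma removable:
  assumes "persistent c w" "\<not> const_window w" "(\<beta> - 1) * c \<le> lam (m - 1)"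
  obtains p where "p < m" "w p" "rest_weight p w < c"
proof -
  obtain p where p: "p < m" "w p" "\<not> w (Suc p mod m)"
    using rotation_const[of w] assms(2) by blast
  define r where "r = Suc p mod m"
  have r: "r < m" "\<not> w r" using p m2 by (auto simp: r_def)
  have e: "m - 1 = Suc (m - 2)" using m2 by simp
  define A where "A = (\<Sum>i<m - 2. lam i * of_bool (w ((r + 1 + i) mod m)))"
  have idx: "(r + 1 + (m - 2)) mod m = p"
  proof -
    have "(r + 1 + (m - 2)) mod m = (Suc p + (m - 1)) mod m"
      unfolding r_def e using mod_add_left_eq[of "Suc p" m "1 + (m - 2)"] by simp
    also have "Suc p + (m - 1) = p + m" using m2 by simp
    finally show ?thesis using p by simp
  qed
  have t: "(r + 1 + i) mod m = (p + 1 + Suc i) mod m" for i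
    unfolding r_def using mod_add_left_eq[of "Suc p" m "1 + i"] by simp
  have rr: "rest_weight r w = A + lam (m - 2)"
    unfolding rest_weight_def e A_def using p idx by simp
  have "rest_weight p w = lam 0 * of_bool (w r) + (\<Sum>i<m - 2. lam (Suc i) * of_bool (w ((p + 1 + Suc i) mod m)))"
    unfolding rest_weight_def e by (subst sum.lessThan_Suc_shift) (simp add: r_def)
  also have "\<dots> = (\<Sum>i<m - 2. lam (Suc i) * of_bool (w ((p + 1 + Suc i) mod m)))"
    using r by simp
  also have "\<dots> = (\<Sum>i<m - 2. \<beta> * (lam i * of_bool (w ((r + 1 + i) mod m))))"
    by (rule sum.cong[OF refl]) (simp only: t lam_Suc mult.assoc)
  also have "\<dots> = \<beta> * A"
    unfolding A_def by (rule sum_distrib_left[symmetric])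
  also have "\<dots> = \<beta> * rest_weight r w - lam (m - 1)"
    unfolding rr e by (simp add: lam_Suc algebra_simps)
  also have "\<dots> < \<beta> * c - lam (m - 1)"
    using assms(1) r beta_pos by (simp add: persistent_def)
  also have "\<dots> \<le> c" using assms(3) by (simp add: algebra_simps)
  finally show ?thesis using that p by blast
qed

text \<open>
  The removable one at position \<open>p\<close> is followed through the rotations: either some one is lost on the
  way, or it is in the last position when the largest threshold \<open>c + lam (m - 1)\<close> occurs, and this threshold
  exceeds its own weight plus its rest weight.
\<close>

lemma remove_one:
  assumes u0: "persistent c (u 0)" and us: "\<And>j. j \<le> N \<Longrightarrow> u (Suc j) = threshold_push (\<tau> j) (u j)"
    and \<tau>: "\<And>j. j \<le> N \<Longrightarrow> c \<le> \<tau> j" "\<And>j. j \<le> N \<Longrightarrow> \<tau> j \<le> c + lam (m - 1)"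
    and last: "\<tau> N = c + lam (m - 1)"
    and p: "p < m" "u 0 p" "rest_weight p (u 0) < c" and N: "(p + N) mod m = m - 1"
  shows "ones (u (Suc N)) < ones (u 0)" and "persistent c (u (Suc N))"
proof -
  have inv: "persistent c (u j) \<and> ones (u j) \<le> ones (u 0) \<and>
      (ones (u j) < ones (u 0) \<or> u j ((p + j) mod m) \<and> rest_weight ((p + j) mod m) (u j) < c)"
    if "j \<le> N" for j
    using that
  proof (induction j)
    case 0
    then show ?case using u0 p by simp
  next
    case (Suc j)
    then have j: "j \<le> N" by simp
    note IH = Suc.IH[OF j]
    define b where "b \<longleftrightarrow> \<tau> j \<le> ell (u j)"
    have uS: "u (Suc j) = case_nat b (u j)" using us[OF j] by (simp add: threshold_push_def b_def)
    have b: "b \<longrightarrow> u j (m - 1)" using persistent_step(2)[of c "u j" "\<tau> j"] IH \<tau>[OF j] by (simp add: b_def)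
    have P: "persistent c (u (Suc j))" using persistent_step(1)[of c "u j" "\<tau> j"] IH \<tau>[OF j] us[OF j] by simp
    have O: "ones (u (Suc j)) + of_bool (u j (m - 1)) = ones (u j) + of_bool b"
      unfolding uS by (rule ones_push)
    show ?case
    proof (cases "ones (u (Suc j)) < ones (u 0)")
      case True
      then show ?thesis using P by simp
    next
      case False
      then have eq: "b = u j (m - 1)" "ones (u j) = ones (u 0)"
        using O b IH by (cases b; cases "u j (m - 1)"; simp)+
      then have "u j ((p + j) mod m)" "rest_weight ((p + j) mod m) (u j) < c" using IH by auto
      moreover have "u (Suc j) (Suc (p + j) mod m)"
        unfolding uS by (rule push_mod_ge) (use eq IH in auto)
      moreover have "rest_weight (Suc (p + j) mod m) (u (Suc j)) \<le> rest_weight ((p + j) mod m) (u j)"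
        unfolding uS by (rule rest_weight_push_le) (rule b)
      ultimately show ?thesis using P O eq by auto
    qed
  qed
  note IN = inv[OF order_refl]
  show "persistent c (u (Suc N))" using persistent_step(1)[of c "u N" "\<tau> N"] IN \<tau>[of N] us[of N] by simp
  define b where "b \<longleftrightarrow> \<tau> N \<le> ell (u N)"
  have uS: "u (Suc N) = case_nat b (u N)" using us[of N] by (simp add: threshold_push_def b_def)
  have b: "b \<longrightarrow> u N (m - 1)" using persistent_step(2)[of c "u N" "\<tau> N"] IN \<tau>[of N] by (simp add: b_def)
  have O: "ones (u (Suc N)) + of_bool (u N (m - 1)) = ones (u N) + of_bool b"
    unfolding uS by (rule ones_push)
  show "ones (u (Suc N)) < ones (u 0)"
  proof (cases "ones (u N) < ones (u 0)")
    case True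
    then show ?thesis using O b by (cases b; cases "u N (m - 1)"; simp)
  next
    case False
    then have k: "u N (m - 1)" "rest_weight (m - 1) (u N) < c" using IN N by auto
    then have "\<not> b" using ell_eq_rest_weight[of "u N"] last by (simp add: b_def)
    then show ?thesis using O k IN by simp
  qed
qed

lemma persistent_steps:
  assumes "persistent c (u 0)" "\<And>j. j < N \<Longrightarrow> u (Suc j) = threshold_push (\<tau> j) (u j)"
    "\<And>j. j < N \<Longrightarrow> c \<le> \<tau> j" "\<And>j. j < N \<Longrightarrow> \<tau> j \<le> c + lam (m - 1)"
  shows "persistent c (u N)"
  using assms
proof (induction N)
  case (Suc N)
  then have "persistent c (u N)" by simp
  then show ?case using persistent_step(1)[of c "u N" "\<tau> N"] Suc.prems by simp
qed simp

end

section \<open>Synchronisation of all windows\<close>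

context multinacci_base
begin

text \<open>
  At regular points \<open>T\<close> is continuous and the next bit is locally constant for every window, jointly in
  \<open>l\<close> and \<open>\<alpha>\<close>.
\<close>

definition regular :: "real \<Rightarrow> real \<Rightarrow> bool" where
  "regular \<alpha> l \<longleftrightarrow> 0 < l \<and> l < 1 \<and> \<beta> * l + \<alpha> \<notin> \<int> \<and> (\<forall>w. l + ell w \<noteq> 1)"

definition regular_orbit :: "real \<Rightarrow> nat \<Rightarrow> real \<Rightarrow> bool" where
  "regular_orbit \<alpha> n l \<longleftrightarrow> (\<forall>j<n. regular \<alpha> ((T \<beta> \<alpha> ^^ j) l))"

text \<open>
  The quantification over all windows frees the argument from knowing which window the orbits
  of \<open>0\<close> and \<open>1\<close> carry when they arrive; the neighbourhood in both variables makes the property usable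
  for nearby parameters.
\<close>

definition sync_point :: "real \<Rightarrow> real \<Rightarrow> bool" where
  "sync_point \<alpha> h \<longleftrightarrow> 0 < h \<and> h < 1 \<and>
     (\<exists>n. \<forall>\<^sub>F p in nhds (\<alpha>, h). \<forall>w. const_window (win (fst p) n (snd p) w))"

lemma tendsto_fst_pair: "((\<lambda>p. fst p) \<longlongrightarrow> \<alpha>) (nhds (\<alpha> :: real, l :: real))"
  using tendsto_fst[OF filterlim_ident[of "nhds (\<alpha>, l)"]] by simp

lemma tendsto_snd_pair: "((\<lambda>p. snd p) \<longlongrightarrow> l) (nhds (\<alpha> :: real, l :: real))"
  using tendsto_snd[OF filterlim_ident[of "nhds (\<alpha>, l)"]] by simp

lemma tendsto_affine_pair:
  "((\<lambda>p. \<beta> * snd p + fst p) \<longlongrightarrow> \<beta> * l + \<alpha>) (nhds (\<alpha>, l :: real))"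
  by (intro tendsto_add tendsto_mult tendsto_const tendsto_fst_pair tendsto_snd_pair)

lemma T_local:
  assumes "\<beta> * l + \<alpha> \<notin> \<int>"
  shows "\<forall>\<^sub>F p in nhds (\<alpha>, l). T \<beta> (fst p) (snd p) = \<beta> * snd p + fst p - of_int \<lfloor>\<beta> * l + \<alpha>\<rfloor>"
  using eventually_floor_eq[OF tendsto_affine_pair assms] by eventually_elim (simp add: T_def)

lemma T_tendsto:
  assumes "\<beta> * l + \<alpha> \<notin> \<int>"
  shows "((\<lambda>p. T \<beta> (fst p) (snd p)) \<longlongrightarrow> T \<beta> \<alpha> l) (nhds (\<alpha>, l))"
proof -
  have "((\<lambda>p. \<beta> * snd p + fst p - of_int \<lfloor>\<beta> * l + \<alpha>\<rfloor>) \<longlongrightarrow> T \<beta> \<alpha> l) (nhds (\<alpha>, l))"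
    unfolding T_def by (intro tendsto_intros tendsto_affine_pair)
  then show ?thesis
    by (rule Lim_transform_eventually) (use T_local[OF assms] in eventually_elim, simp)
qed

lemma hit_stable:
  assumes "(f \<longlongrightarrow> l) F" "\<And>w. l + ell w \<noteq> 1"
  shows "\<forall>\<^sub>F x in F. \<forall>w. hit (f x) w = hit l w"
proof -
  have "\<forall>\<^sub>F x in F. \<forall>v\<in>range ell. (1 \<le> f x + v) = (1 \<le> l + v)"
  proof (rule eventually_ball_finite[OF finite_range_ell], rule ballI)
    fix v assume "v \<in> range ell"
    then have ne: "l + v \<noteq> 1" using assms(2) by auto
    have lim: "((\<lambda>x. f x + v) \<longlongrightarrow> l + v) F" by (intro tendsto_intros assms)
    show "\<forall>\<^sub>F x in F. (1 \<le> f x + v) = (1 \<le> l + v)"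
    proof (cases "1 < l + v")
      case True
      show ?thesis using order_tendstoD(1)[OF lim True] by eventually_elim (use True in simp)
    next
      case False
      then have "l + v < 1" using ne by simp
      from order_tendstoD(2)[OF lim this] show ?thesis by eventually_elim (use \<open>l + v < 1\<close> in simp)
    qed
  qed
  then show ?thesis by eventually_elim simp
qed

lemma regular_orbit_stable:
  assumes "regular_orbit \<alpha> n l"
  shows "((\<lambda>p. (T \<beta> (fst p) ^^ n) (snd p)) \<longlongrightarrow> (T \<beta> \<alpha> ^^ n) l) (nhds (\<alpha>, l))"
    and "\<forall>\<^sub>F p in nhds (\<alpha>, l). \<forall>w. win (fst p) n (snd p) w = win \<alpha> n l w"
  using assms
proof (induction n)
  case 0
  { case 1 show ?case using tendsto_snd_pair by simp }
  { case 2 show ?case by simp }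
next
  case (Suc n)
  { case 1
    then have r: "regular_orbit \<alpha> n l" "regular \<alpha> ((T \<beta> \<alpha> ^^ n) l)" by (auto simp: regular_orbit_def)
    have "filterlim (\<lambda>p. (fst p, (T \<beta> (fst p) ^^ n) (snd p))) (nhds (\<alpha>, (T \<beta> \<alpha> ^^ n) l)) (nhds (\<alpha>, l))"
      by (intro tendsto_Pair tendsto_fst_pair Suc.IH(1) r)
    from filterlim_compose[OF T_tendsto this] r
    show ?case by (simp add: regular_def) }
  { case 2
    then have r: "regular_orbit \<alpha> n l" "regular \<alpha> ((T \<beta> \<alpha> ^^ n) l)" by (auto simp: regular_orbit_def)
    have h: "\<forall>\<^sub>F p in nhds (\<alpha>, l). \<forall>w. hit ((T \<beta> (fst p) ^^ n) (snd p)) w = hit ((T \<beta> \<alpha> ^^ n) l) w"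
      by (rule hit_stable[OF Suc.IH(1)[OF r(1)]]) (use r(2) in \<open>simp add: regular_def\<close>)
    from h Suc.IH(2)[OF r(1)] show ?case
      by eventually_elim (intro allI, simp only: win_Suc) }
qed

lemma eventually_second:
  assumes "\<forall>\<^sub>F p in nhds (\<alpha>, l). P (fst p) (snd p)" shows "\<forall>\<^sub>F x in nhds (l :: real). P (\<alpha> :: real) x"
proof -
  have "filterlim (\<lambda>x. (\<alpha>, x)) (nhds (\<alpha>, l)) (nhds l)"
    by (intro tendsto_Pair tendsto_const filterlim_ident)
  from eventually_compose_filterlim[OF assms this] show ?thesis by simp
qed

lemma regular_open:
  assumes "regular \<alpha> l" "(f \<longlongrightarrow> l) F" shows "\<forall>\<^sub>F x in F. regular \<alpha> (f x)"
proof -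
  have "closed (\<int> :: real set)" by (rule closed_Ints)
  then have "open (- \<int> :: real set)" by (simp add: open_Compl)
  moreover have "((\<lambda>x. \<beta> * f x + \<alpha>) \<longlongrightarrow> \<beta> * l + \<alpha>) F" by (intro tendsto_intros assms)
  ultimately have "\<forall>\<^sub>F x in F. \<beta> * f x + \<alpha> \<in> - \<int>"
    using assms(1) by (intro topological_tendstoD) (auto simp: regular_def)
  moreover have "\<forall>\<^sub>F x in F. 0 < f x" "\<forall>\<^sub>F x in F. f x < 1"
    using assms order_tendstoD[OF assms(2)] by (auto simp: regular_def)
  moreover have "\<forall>\<^sub>F x in F. \<forall>v\<in>range ell. f x + v \<noteq> 1"
  proof (rule eventually_ball_finite[OF finite_range_ell], rule ballI)
    fix v assume "v \<in> range ell"
    then have "l + v \<noteq> 1" using assms by (auto simp: regular_def)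
    moreover have "((\<lambda>x. f x + v) \<longlongrightarrow> l + v) F" by (intro tendsto_intros assms)
    ultimately show "\<forall>\<^sub>F x in F. f x + v \<noteq> 1" by (metis tendsto_imp_eventually_ne)
  qed
  ultimately show ?thesis by eventually_elim (auto simp: regular_def)
qed

lemma regular_orbit_affine:
  assumes "regular_orbit \<alpha> n l"
  shows "\<forall>\<^sub>F x in nhds l. (T \<beta> \<alpha> ^^ n) x = (T \<beta> \<alpha> ^^ n) l + \<beta> ^ n * (x - l)"
    and "\<forall>\<^sub>F x in nhds l. regular_orbit \<alpha> n x"
  using assms
proof (induction n)
  case 0
  { case 1 show ?case by simp }
  { case 2 show ?case by (simp add: regular_orbit_def) }
next
  case (Suc n)
  have lim: "((\<lambda>x. (T \<beta> \<alpha> ^^ n) x) \<longlongrightarrow> (T \<beta> \<alpha> ^^ n) l) (nhds l)" if "regular_orbit \<alpha> n l"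
  proof -
    have "filterlim (\<lambda>x. (\<alpha>, x)) (nhds (\<alpha>, l)) (nhds l)"
      by (intro tendsto_Pair tendsto_const filterlim_ident)
    from filterlim_compose[OF regular_orbit_stable(1)[OF that] this] show ?thesis by simp
  qed
  { case 1
    then have r: "regular_orbit \<alpha> n l" "regular \<alpha> ((T \<beta> \<alpha> ^^ n) l)" by (auto simp: regular_orbit_def)
    let ?y = "(T \<beta> \<alpha> ^^ n) l"
    have "\<forall>\<^sub>F y in nhds ?y. T \<beta> \<alpha> y = \<beta> * y + \<alpha> - of_int \<lfloor>\<beta> * ?y + \<alpha>\<rfloor>"
      using eventually_second[OF T_local[of ?y \<alpha>]] r by (simp add: regular_def)
    from eventually_compose_filterlim[OF this lim[OF r(1)]] Suc.IH(1)[OF r(1)]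
    show ?case
    proof eventually_elim
      case (elim x)
      have "T \<beta> \<alpha> ?y = \<beta> * ?y + \<alpha> - of_int \<lfloor>\<beta> * ?y + \<alpha>\<rfloor>" by (simp add: T_def)
      then have "T \<beta> \<alpha> ((T \<beta> \<alpha> ^^ n) x) = T \<beta> \<alpha> ?y + \<beta> * ((T \<beta> \<alpha> ^^ n) x - ?y)"
        unfolding elim(1) by (simp add: right_diff_distrib)
      also have "(T \<beta> \<alpha> ^^ n) x - ?y = \<beta> ^ n * (x - l)" unfolding elim(2) by simp
      finally show ?case by (simp add: mult.assoc)
    qed }
  { case 2
    then have r: "regular_orbit \<alpha> n l" "regular \<alpha> ((T \<beta> \<alpha> ^^ n) l)" by (auto simp: regular_orbit_def)
    from regular_open[OF r(2) lim[OF r(1)]] Suc.IH(2)[OF r(1)]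
    show ?case by eventually_elim (auto simp: regular_orbit_def less_Suc_eq) }
qed

lemma regular_orbit_add:
  "regular_orbit \<alpha> k l \<Longrightarrow> regular_orbit \<alpha> n ((T \<beta> \<alpha> ^^ k) l) \<Longrightarrow> regular_orbit \<alpha> (n + k) l"
proof -
  assume a: "regular_orbit \<alpha> k l" "regular_orbit \<alpha> n ((T \<beta> \<alpha> ^^ k) l)"
  have "regular \<alpha> ((T \<beta> \<alpha> ^^ j) l)" if "j < n + k" for j
  proof (cases "j < k")
    case False
    then have "regular \<alpha> ((T \<beta> \<alpha> ^^ (j - k)) ((T \<beta> \<alpha> ^^ k) l))" using a(2) that by (simp add: regular_orbit_def)
    then have "regular \<alpha> ((T \<beta> \<alpha> ^^ (j - k + k)) l)" by (simp only: funpow_add comp_apply)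
    then show ?thesis using False by simp
  qed (use a in \<open>simp add: regular_orbit_def\<close>)
  then show ?thesis by (simp add: regular_orbit_def)
qed

lemma const_win:
  assumes "regular_orbit \<alpha> n l" "const_window w" shows "const_window (win \<alpha> n l w)"
  using assms(1)
proof (induction n)
  case (Suc n)
  then have "regular_orbit \<alpha> n l" "regular \<alpha> ((T \<beta> \<alpha> ^^ n) l)" by (auto simp: regular_orbit_def)
  then show ?case unfolding win_Suc using Suc.IH by (intro const_step) (auto simp: regular_def)
qed (use assms in simp)

lemma win_cong:
  assumes "\<And>i. i < m \<Longrightarrow> w i = w' i"
  shows "i < m \<Longrightarrow> win \<alpha> n l w i = win \<alpha> n l w' i"
proof (induction n arbitrary: i)
  case (Suc n)
  have "ell (win \<alpha> n l w) = ell (win \<alpha> n l w')" by (rule ell_cong) (rule Suc.IH)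
  then show ?case unfolding win_Suc using Suc by (auto split: nat.split)
qed (use assms in simp)

lemma const_window_cong: "(\<And>i. i < m \<Longrightarrow> w i = w' i) \<Longrightarrow> const_window w = const_window w'"
  by (simp add: const_window_def)

lemma finite_windows: "finite {w. \<forall>i\<ge>m. \<not> w i}"
proof -
  have "{w. \<forall>i\<ge>m. \<not> w i} \<subseteq> (\<lambda>A i. i \<in> A) ` Pow {..<m}"
  proof
    fix w assume w: "w \<in> {w. \<forall>i\<ge>m. \<not> w i}"
    then have "w = (\<lambda>i. i \<in> {i. w i})" "{i. w i} \<in> Pow {..<m}" by (auto simp: not_le[symmetric])
    then show "w \<in> (\<lambda>A i. i \<in> A) ` Pow {..<m}" by (rule image_eqI)
  qed
  then show ?thesis by (rule finite_subset) simp
qed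

lemma sync_point_preimage:
  assumes "sync_point \<alpha> (T \<beta> \<alpha> h)" "0 < h" "h < 1" "\<beta> * h + \<alpha> \<notin> \<int>"
  shows "sync_point \<alpha> h"
proof -
  obtain n where n: "\<forall>\<^sub>F p in nhds (\<alpha>, T \<beta> \<alpha> h). \<forall>w. const_window (win (fst p) n (snd p) w)"
    using assms by (auto simp: sync_point_def)
  have "filterlim (\<lambda>p. (fst p, T \<beta> (fst p) (snd p))) (nhds (\<alpha>, T \<beta> \<alpha> h)) (nhds (\<alpha>, h))"
    by (intro tendsto_Pair tendsto_fst_pair T_tendsto assms)
  from eventually_compose_filterlim[OF n this]
  have "\<forall>\<^sub>F p in nhds (\<alpha>, h). \<forall>w. const_window (win (fst p) (n + 1) (snd p) w)"
  proof eventually_elim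
    case (elim p)
    show ?case unfolding win_add using elim by simp
  qed
  then show ?thesis unfolding sync_point_def using assms by blast
qed

end

text \<open>
  Here \<open>c\<close> is the distance from the fixed point \<open>z\<close> to \<open>1\<close>, that is, the threshold for the arc length at
  \<open>z\<close>. The bound \<open>\<alpha> < q / \<beta>\<close> says \<open>z > \<alpha>\<close>, which puts the preimage \<open>z - q / \<beta>\<close> into the unit
  interval. Absence of ties makes the loops below regular.
\<close>

locale sync_setting = multinacci_base +
  fixes \<alpha> :: real and c :: real
  assumes al: "eps < \<alpha>" "\<alpha> < real q / \<beta>"
    and c_def: "c = (\<alpha> - eps) / (\<beta> - 1)"
    and no_tie: "\<And>w. ell w \<noteq> c" "\<And>i w. ell w \<noteq> c + real q / \<beta> ^ Suc i"
begin

text \<open>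
  The points \<open>y N, y (N - 1), \<dots>, y 0, z\<close> form a loop: \<open>y N\<close> is close to \<open>z\<close> for large \<open>N\<close>, and
  \<open>y 0 = z - q / \<beta>\<close>.
\<close>

definition z :: real where "z = 1 - c"
definition y :: "nat \<Rightarrow> real" where "y i = z - real q / \<beta> ^ Suc i"

lemma c_pos: "0 < c" using al beta_gt_1 by (simp add: c_def)

lemma fixed: "\<beta> * z + \<alpha> = real q + z"
proof -
  have "(\<beta> - 1) * c = \<alpha> - eps" using beta_gt_1 by (simp add: c_def)
  then show ?thesis by (simp add: z_def eps_def algebra_simps)
qed

lemma z_gt: "real q / \<beta> < z"
proof -
  have "(\<beta> - 1) * z = real q - \<alpha>" using fixed by (simp add: algebra_simps)
  moreover have "(\<beta> - 1) * (real q / \<beta>) < real q - \<alpha>"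
    using al beta_pos by (simp add: field_simps)
  ultimately have "(\<beta> - 1) * (real q / \<beta>) < (\<beta> - 1) * z" by simp
  then show ?thesis by (rule mult_left_less_imp_less) (use beta_gt_1 in simp)
qed

lemma z_lt_1: "z < 1" using c_pos by (simp add: z_def)

text \<open>
  Both bounds follow from \<open>z > q / \<beta>\<close>. The first one says that ones survive near \<open>z\<close>, the second one is what
  produces removable ones.
\<close>

lemma c_le: "c \<le> lam (m - 1)" and c_le2: "(\<beta> - 1) * c \<le> lam (m - 1)"
proof -
  have c: "c < 1 - real q / \<beta>" using z_gt by (simp add: z_def)
  have "\<beta> \<le> 2 * real q" using beta_lt q1 by simp
  then have "1 - real q / \<beta> \<le> real q / \<beta>" using beta_pos by (simp add: field_simps)
  then show "c \<le> lam (m - 1)" using c unfolding lam_last by linarith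
  have "(\<beta> - 1) * c \<le> (\<beta> - 1) * (1 - real q / \<beta>)" using c beta_gt_1 by (intro mult_left_mono) auto
  also have "\<dots> = (\<beta> - 1) * ((\<beta> - real q) / \<beta>)" using beta_pos by (simp add: field_simps)
  also have "\<dots> \<le> real q / \<beta>"
  proof -
    have "(\<beta> - 1) * (\<beta> - real q) \<le> real q * 1"
      using beta_lt beta_gt_q beta_gt_1 by (intro mult_mono) auto
    then show ?thesis using beta_pos by (simp add: divide_right_mono)
  qed
  finally show "(\<beta> - 1) * c \<le> lam (m - 1)" unfolding lam_last .
qed

lemma power_bounds: "0 < real q / \<beta> ^ Suc i" "real q / \<beta> ^ Suc i \<le> real q / \<beta>"
proof -
  show "0 < real q / \<beta> ^ Suc i" using q1 beta_pos by simp
  have "\<beta> ^ 1 \<le> \<beta> ^ Suc i" using beta_gt_1 by (intro power_increasing) auto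
  then show "real q / \<beta> ^ Suc i \<le> real q / \<beta>" using beta_pos by (intro divide_left_mono) auto
qed

lemma y_bounds: "0 < y i" "y i < z"
  using power_bounds[of i] z_gt by (auto simp: y_def)

lemma beta_y: "\<beta> * y i + \<alpha> = real q + z - real q / \<beta> ^ i"
  using beta_pos by (simp add: y_def right_diff_distrib fixed[symmetric])

lemma T_y0: "T \<beta> \<alpha> (y 0) = z"
proof -
  have "\<beta> * y 0 + \<alpha> = z" using beta_y[of 0] by simp
  moreover have "frac z = z" using z_lt_1 y_bounds[of 0] by (simp add: frac_eq)
  ultimately show ?thesis by (simp add: T_frac)
qed

lemma T_y_Suc: "T \<beta> \<alpha> (y (Suc i)) = y i"
proof -
  have "\<beta> * y (Suc i) + \<alpha> = y i + of_int (int q)" using beta_y[of "Suc i"] by (simp add: y_def)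
  moreover have "frac (y i) = y i" using z_lt_1 y_bounds[of i] by (simp add: frac_eq)
  moreover have "frac (y i + of_int (int q)) = frac (y i)" by (rule frac_eq_if_diff_int) simp
  ultimately show ?thesis by (simp only: T_frac)
qed

lemma T_y: "j \<le> N \<Longrightarrow> (T \<beta> \<alpha> ^^ j) (y N) = y (N - j)"
proof (induction j)
  case (Suc j)
  then have "N - j = Suc (N - Suc j)" by simp
  then show ?case using Suc T_y_Suc[of "N - Suc j"] by simp
qed simp

lemma T_y_end: "(T \<beta> \<alpha> ^^ Suc N) (y N) = z"
  using T_y[of N N] T_y0 by simp

lemma regular_y: "regular \<alpha> (y i)"
  unfolding regular_def
proof (intro conjI allI)
  show "0 < y i" "y i < 1" using y_bounds[of i] z_lt_1 by auto
  show "\<beta> * y i + \<alpha> \<notin> \<int>"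
  proof
    assume "\<beta> * y i + \<alpha> \<in> \<int>"
    then have f: "frac (\<beta> * y i + \<alpha>) = 0" by (simp add: frac_eq_0_iff)
    show False
    proof (cases i)
      case 0
      then show ?thesis using f T_y0 y_bounds[of 0] unfolding T_frac by simp
    next
      case (Suc j)
      then show ?thesis using f T_y_Suc[of j] y_bounds[of j] unfolding T_frac by simp
    qed
  qed
  show "y i + ell w \<noteq> 1" for w
    using no_tie(2)[of w i] by (simp add: y_def z_def)
qed

lemma regular_orbit_y: "regular_orbit \<alpha> (Suc N) (y N)"
  unfolding regular_orbit_def
proof (intro allI impI)
  fix j assume "j < Suc N"
  then show "regular \<alpha> ((T \<beta> \<alpha> ^^ j) (y N))" using T_y[of j N] regular_y by simp
qed

text \<open>
  The thresholds met along a loop increase from almost \<open>c\<close> to \<open>c + q / \<beta> = c + lam (m - 1)\<close>.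
\<close>

lemma win_y:
  "j \<le> N \<Longrightarrow> win \<alpha> (Suc j) (y N) w = threshold_push (c + real q / \<beta> ^ Suc (N - j)) (win \<alpha> j (y N) w)"
proof -
  assume j: "j \<le> N"
  have "hit (y (N - j)) v = (c + real q / \<beta> ^ Suc (N - j) \<le> ell v)" for v
    by (auto simp: y_def z_def)
  then show ?thesis unfolding win_Suc T_y[OF j] threshold_push_def by simp
qed

lemma tau_bounds:
  "c \<le> c + real q / \<beta> ^ Suc i" "c + real q / \<beta> ^ Suc i \<le> c + lam (m - 1)"
  unfolding lam_last using power_bounds[of i] by linarith+

lemma tail_lim: "(\<lambda>i. real q / \<beta> ^ Suc i) \<longlonglongrightarrow> 0"
proof -
  have "(\<lambda>i. real q * inverse \<beta> ^ Suc i) \<longlonglongrightarrow> real q * 0"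
    using beta_gt_1
    by (intro tendsto_mult tendsto_const LIMSEQ_Suc[OF LIMSEQ_power_zero]) (simp add: inverse_less_1_iff)
  then show ?thesis by (simp add: field_simps power_inverse)
qed

lemma y_lim: "0 < \<delta> \<Longrightarrow> \<exists>N0. \<forall>N\<ge>N0. \<bar>y N - z\<bar> < \<delta>"
  using tail_lim by (auto simp: LIMSEQ_def y_def dist_real_def)

lemma far_threshold:
  "\<exists>K. \<forall>i\<ge>K. \<forall>w. (c + real q / \<beta> ^ Suc i \<le> ell w) = (c \<le> ell w)"
proof -
  have "\<forall>\<^sub>F i in sequentially. \<forall>w. hit (1 - (c + real q / \<beta> ^ Suc i)) w = hit (1 - (c + 0)) w"
    by (rule hit_stable[OF tendsto_diff[OF tendsto_const tendsto_add[OF tendsto_const tail_lim]]])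
      (use no_tie(1) in \<open>simp add: algebra_simps\<close>)
  then obtain K where K: "\<And>i w. i \<ge> K \<Longrightarrow> hit (1 - (c + real q / \<beta> ^ Suc i)) w = hit (1 - (c + 0)) w"
    by (auto simp: eventually_sequentially)
  show ?thesis
  proof (intro exI allI impI)
    fix i w assume "K \<le> i"
    from K[OF this, of w] show "(c + real q / \<beta> ^ Suc i \<le> ell w) = (c \<le> ell w)" by linarith
  qed
qed

definition returns :: "real \<Rightarrow> nat \<Rightarrow> bool" where
  "returns l n \<longleftrightarrow> regular_orbit \<alpha> n l \<and> (T \<beta> \<alpha> ^^ n) l = z"

definition sync :: "(nat \<Rightarrow> bool) list \<Rightarrow> bool" where
  "sync ws \<longleftrightarrow> (\<forall>\<delta>>0. \<exists>l n. \<bar>l - z\<bar> < \<delta> \<and> returns l n \<and> (\<forall>w\<in>set ws. const_window (win \<alpha> n l w)))"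

lemma returns_y: "returns (y N) (Suc N)"
  unfolding returns_def using regular_orbit_y T_y_end by blast

text \<open>
  Since \<open>T ^ n\<close> is locally affine at a regular orbit, the end point \<open>z\<close> of the first piece can be moved to
  any start \<open>l2\<close> of a second piece near \<open>z\<close> by moving its start slightly; the windows do not notice.
\<close>

lemma compose:
  assumes r: "returns l n" and \<delta>: "0 < \<delta>"
    and s: "\<And>\<delta>. 0 < \<delta> \<Longrightarrow> \<exists>l n. \<bar>l - z\<bar> < \<delta> \<and> returns l n \<and> Q l n"
  shows "\<exists>l' l2 n2. \<bar>l' - l\<bar> < \<delta> \<and> returns l' (n2 + n) \<and> returns l2 n2 \<and> Q l2 n2 \<and>
     (\<forall>w. win \<alpha> (n2 + n) l' w = win \<alpha> n2 l2 (win \<alpha> n l w))"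
proof -
  have R: "regular_orbit \<alpha> n l" and Tz: "(T \<beta> \<alpha> ^^ n) l = z" using r by (auto simp: returns_def)
  have w: "\<forall>\<^sub>F x in nhds l. \<forall>w. win \<alpha> n x w = win \<alpha> n l w"
    by (rule eventually_second[where P = "\<lambda>a x. \<forall>w. win a n x w = win \<alpha> n l w"]) (rule regular_orbit_stable(2)[OF R])
  have "\<forall>\<^sub>F x in nhds l. ((\<forall>w. win \<alpha> n x w = win \<alpha> n l w) \<and> regular_orbit \<alpha> n x) \<and>
      (T \<beta> \<alpha> ^^ n) x = (T \<beta> \<alpha> ^^ n) l + \<beta> ^ n * (x - l)"
    by (intro eventually_conj w regular_orbit_affine R)
  then obtain d where d: "0 < d" and near: "\<And>x. \<bar>x - l\<bar> < d \<Longrightarrow> (\<forall>w. win \<alpha> n x w = win \<alpha> n l w) \<and> regular_orbit \<alpha> n x \<and>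
      (T \<beta> \<alpha> ^^ n) x = z + \<beta> ^ n * (x - l)"
    unfolding eventually_nhds_metric dist_real_def Tz by blast
  have bn: "0 < \<beta> ^ n" using beta_pos by simp
  obtain l2 n2 where l2: "\<bar>l2 - z\<bar> < min d \<delta> * \<beta> ^ n" "returns l2 n2" "Q l2 n2"
    using s[of "min d \<delta> * \<beta> ^ n"] d \<delta> bn by auto
  define l' where "l' = l + (l2 - z) / \<beta> ^ n"
  have "\<bar>l' - l\<bar> = \<bar>l2 - z\<bar> / \<beta> ^ n" using bn by (simp add: l'_def)
  then have close: "\<bar>l' - l\<bar> < min d \<delta>" using l2(1) bn by (simp only: divide_less_eq if_True)
  then have N: "\<forall>w. win \<alpha> n l' w = win \<alpha> n l w" "regular_orbit \<alpha> n l'" "(T \<beta> \<alpha> ^^ n) l' = z + \<beta> ^ n * (l' - l)"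
    using near[of l'] by auto
  have Tl': "(T \<beta> \<alpha> ^^ n) l' = l2" using N(3) bn beta_pos by (simp add: l'_def)
  have "regular_orbit \<alpha> (n2 + n) l'" by (rule regular_orbit_add) (use N Tl' l2 in \<open>auto simp: returns_def\<close>)
  moreover have "(T \<beta> \<alpha> ^^ (n2 + n)) l' = z" using Tl' l2 by (simp add: funpow_add returns_def)
  moreover have "win \<alpha> (n2 + n) l' w = win \<alpha> n2 l2 (win \<alpha> n l w)" for w
    unfolding win_add Tl' using N(1) by simp
  ultimately show ?thesis using close l2 unfolding returns_def by fastforce
qed

lemma sync_compose:
  assumes "returns l n" "sync (map (win \<alpha> n l) ws)" "\<And>w. w \<in> set ws' \<Longrightarrow> const_window (win \<alpha> n l w)" "0 < \<delta>"
  shows "\<exists>l' n'. \<bar>l' - l\<bar> < \<delta> \<and> returns l' n' \<and> (\<forall>w\<in>set (ws @ ws'). const_window (win \<alpha> n' l' w))"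
proof -
  define Q where "Q = (\<lambda>l2 n2. \<forall>w\<in>set ws. const_window (win \<alpha> n2 l2 (win \<alpha> n l w)))"
  have "\<exists>l' l2 n2. \<bar>l' - l\<bar> < \<delta> \<and> returns l' (n2 + n) \<and> returns l2 n2 \<and> Q l2 n2 \<and>
     (\<forall>w. win \<alpha> (n2 + n) l' w = win \<alpha> n2 l2 (win \<alpha> n l w))"
    by (rule compose[OF assms(1) assms(4)]) (use assms(2) in \<open>auto simp: sync_def Q_def\<close>)
  then obtain l' l2 n2 where *: "\<bar>l' - l\<bar> < \<delta>" "returns l' (n2 + n)" "returns l2 n2" "Q l2 n2"
     "\<And>w. win \<alpha> (n2 + n) l' w = win \<alpha> n2 l2 (win \<alpha> n l w)" by blast
  have "const_window (win \<alpha> (n2 + n) l' w)" if "w \<in> set (ws @ ws')" for w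
    unfolding *(5)
  proof (cases "w \<in> set ws")
    case True
    then show "const_window (win \<alpha> n2 l2 (win \<alpha> n l w))" using *(4) by (simp add: Q_def)
  next
    case False
    then have "const_window (win \<alpha> n l w)" using that assms(3) by simp
    then show "const_window (win \<alpha> n2 l2 (win \<alpha> n l w))"
      using *(3) by (intro const_win[of _ n2]) (auto simp: returns_def)
  qed
  then show ?thesis using *(1,2) by blast
qed

text \<open>
  Each loop, of a length adapted to a removable one, reduces the number of ones.
\<close>

lemma sync_persistent: "persistent c w \<Longrightarrow> sync [w]"
proof (induction "ones w" arbitrary: w rule: less_induct)
  case less
  show ?case
    unfolding sync_def
  proof (intro allI impI)
    fix \<delta> :: real assume \<delta>: "0 < \<delta>"
    obtain N0 where N0: "\<And>N. N \<ge> N0 \<Longrightarrow> \<bar>y N - z\<bar> < \<delta> / 2" using y_lim[of "\<delta> / 2"] \<delta> by auto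
    show "\<exists>l n. \<bar>l - z\<bar> < \<delta> \<and> returns l n \<and> (\<forall>v\<in>set [w]. const_window (win \<alpha> n l v))"
    proof (cases "const_window w")
      case True
      have "const_window (win \<alpha> (Suc N0) (y N0) w)" using True regular_orbit_y by (intro const_win)
      then show ?thesis using returns_y[of N0] N0[of N0] \<delta> by (intro exI[of _ "y N0"] exI[of _ "Suc N0"]) simp
    next
      case False
      obtain p where p: "p < m" "w p" "rest_weight p w < c"
        using removable[OF less.prems False c_le2] by blast
      \<comment> \<open>the residue modulo \<open>m\<close> brings the bit at \<open>p\<close> to the last position after \<open>N\<close> steps\<close>
      define N where "N = (m - 1 - p) + m * N0"
      have "p + N = (m - 1) + m * N0" using p by (simp add: N_def)
      moreover have "((m - 1) + m * N0) mod m = (m - 1) mod m" by (rule mod_mult_self2)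
      ultimately have N: "(p + N) mod m = m - 1" using m2 by simp
      have "N0 \<le> N" using m2 by (simp add: N_def trans_le_add2)
      define u where "u j = win \<alpha> j (y N) w" for j
      define \<tau> where "\<tau> j = c + real q / \<beta> ^ Suc (N - j)" for j
      have us: "u (Suc j) = threshold_push (\<tau> j) (u j)" if "j \<le> N" for j
        unfolding u_def \<tau>_def by (rule win_y[OF that])
      have u0: "u 0 = w" by (simp add: u_def)
      have \<tau>: "c \<le> \<tau> j" "\<tau> j \<le> c + lam (m - 1)" for j unfolding \<tau>_def by (rule tau_bounds)+
      have \<tau>N: "\<tau> N = c + lam (m - 1)" unfolding \<tau>_def lam_last by simp
      have start: "persistent c (u 0)" "u 0 p" "rest_weight p (u 0) < c" using less.prems p u0 by auto
      note rem = remove_one[where u = u and \<tau> = \<tau>, OF start(1) us \<tau> \<tau>N p(1) start(2,3) N]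
      have "ones (u (Suc N)) < ones (u 0)" "persistent c (u (Suc N))" by (rule rem; assumption)+
      then have S: "sync [u (Suc N)]" using less.hyps[of "u (Suc N)"] u0 by simp
      then have S': "sync (map (win \<alpha> (Suc N) (y N)) [w])" by (simp add: u_def del: funpow.simps)
      obtain l' n' where "\<bar>l' - y N\<bar> < \<delta> / 2" "returns l' n'" "\<forall>v\<in>set ([w] @ []). const_window (win \<alpha> n' l' v)"
        using sync_compose[OF returns_y S', of "[]" "\<delta> / 2"] \<delta> by auto
      moreover have "\<bar>y N - z\<bar> < \<delta> / 2" using N0[OF \<open>N0 \<le> N\<close>] .
      moreover from calculation have "\<bar>l' - z\<bar> < \<delta>" by linarith
      ultimately show ?thesis by (intro exI[of _ l'] exI[of _ n']) simp
    qed
  qed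
qed

text \<open>
  A first loop that stays near \<open>z\<close> long enough makes the window persistent.
\<close>

lemma sync_single: "sync [w]"
  unfolding sync_def
proof (intro allI impI)
  fix \<delta> :: real assume \<delta>: "0 < \<delta>"
  obtain N0 where N0: "\<And>N. N \<ge> N0 \<Longrightarrow> \<bar>y N - z\<bar> < \<delta> / 2" using y_lim[of "\<delta> / 2"] \<delta> by auto
  obtain K where K: "\<And>i w. i \<ge> K \<Longrightarrow> (c + real q / \<beta> ^ Suc i \<le> ell w) = (c \<le> ell w)"
    using far_threshold by blast
  obtain t where t: "persistent c ((threshold_push c ^^ t) w)" using reach_persistent[OF c_le] by blast
  define N where "N = N0 + K + t"
  have near: "win \<alpha> j (y N) w = (threshold_push c ^^ j) w" if "j \<le> t" for j
    using that
  proof (induction j)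
    case (Suc j)
    then have "win \<alpha> (Suc j) (y N) w = threshold_push (c + real q / \<beta> ^ Suc (N - j)) ((threshold_push c ^^ j) w)"
      using win_y[of j N w] by (simp add: N_def)
    also have "\<dots> = threshold_push c ((threshold_push c ^^ j) w)"
      using K[of "N - j"] Suc.prems by (simp add: threshold_push_def N_def)
    finally show ?case by simp
  qed simp
  define u where "u j = win \<alpha> (t + j) (y N) w" for j
  have "persistent c (u (Suc N - t))"
  proof (rule persistent_steps[where \<tau> = "\<lambda>j. c + real q / \<beta> ^ Suc (N - (t + j))"])
    show "persistent c (u 0)" using t near[of t] by (simp add: u_def)
    show "u (Suc j) = threshold_push (c + real q / \<beta> ^ Suc (N - (t + j))) (u j)" if "j < Suc N - t" for j
    proof -
      have "t + j \<le> N" using that by simp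
      from win_y[OF this, of w] show ?thesis by (simp add: u_def)
    qed
  qed (rule tau_bounds)+
  moreover have "t + (Suc N - t) = Suc N" by (simp add: N_def)
  ultimately have P: "persistent c (win \<alpha> (Suc N) (y N) w)" by (simp only: u_def)
  have S: "sync (map (win \<alpha> (Suc N) (y N)) [w])" using sync_persistent[OF P] by simp
  obtain l' n' where "\<bar>l' - y N\<bar> < \<delta> / 2" "returns l' n'" "\<forall>v\<in>set ([w] @ []). const_window (win \<alpha> n' l' v)"
    using sync_compose[OF returns_y S, of "[]" "\<delta> / 2"] \<delta> by auto
  moreover have "\<bar>y N - z\<bar> < \<delta> / 2" by (rule N0) (simp add: N_def)
  moreover from calculation have "\<bar>l' - z\<bar> < \<delta>" by linarith
  ultimately show "\<exists>l n. \<bar>l - z\<bar> < \<delta> \<and> returns l n \<and> (\<forall>v\<in>set [w]. const_window (win \<alpha> n l v))"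
    by (intro exI[of _ l'] exI[of _ n']) simp
qed

text \<open>
  The windows are treated one after the other; those that are already constant stay constant.
\<close>

lemma sync_list: "sync ws"
proof (induction "length ws" arbitrary: ws)
  case 0
  then show ?case using sync_single by (simp add: sync_def) blast
next
  case (Suc k)
  then obtain w vs where ws: "ws = w # vs" "length vs = k" by (cases ws) auto
  show ?case
    unfolding sync_def
  proof (intro allI impI)
    fix \<delta> :: real assume \<delta>: "0 < \<delta>"
    then obtain l n where l: "\<bar>l - z\<bar> < \<delta> / 2" "returns l n" "const_window (win \<alpha> n l w)"
      using sync_single[of w, unfolded sync_def, rule_format, of "\<delta> / 2"] by auto
    have "sync (map (win \<alpha> n l) vs)" using Suc.hyps(1)[of "map (win \<alpha> n l) vs"] ws by simp
    from sync_compose[OF l(2) this, of "[w]" "\<delta> / 2"] l(3) \<delta>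
    obtain l' n' where "\<bar>l' - l\<bar> < \<delta> / 2" "returns l' n'" "\<forall>v\<in>set (vs @ [w]). const_window (win \<alpha> n' l' v)"
      by auto
    then show "\<exists>l n. \<bar>l - z\<bar> < \<delta> \<and> returns l n \<and> (\<forall>v\<in>set ws. const_window (win \<alpha> n l v))"
      using l(1) ws by (intro exI[of _ l'] exI[of _ n']) (auto simp: abs_if split: if_splits)
  qed
qed

lemma sync_point_near_z:
  assumes "0 < \<delta>" shows "\<exists>h. \<bar>h - z\<bar> < \<delta> \<and> sync_point \<alpha> h"
proof -
  obtain ws where ws: "set ws = {w. \<forall>i\<ge>m. \<not> w i}" using finite_list[OF finite_windows] by blast
  define d where "d = min \<delta> (min z (1 - z))"
  have d: "0 < d" using assms z_lt_1 y_bounds[of 0] by (simp add: d_def)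
  then obtain l n where l: "\<bar>l - z\<bar> < d" "returns l n" "\<And>w. w \<in> set ws \<Longrightarrow> const_window (win \<alpha> n l w)"
    using sync_list[of ws] unfolding sync_def by blast
  have const: "const_window (win \<alpha> n l w)" for w
  proof -
    define w' where "w' i \<longleftrightarrow> i < m \<and> w i" for i
    have "const_window (win \<alpha> n l w')" using l(3)[of w'] ws by (simp add: w'_def)
    moreover have "const_window (win \<alpha> n l w) = const_window (win \<alpha> n l w')"
      by (rule const_window_cong, rule win_cong) (simp_all add: w'_def)
    ultimately show ?thesis by simp
  qed
  have "\<forall>\<^sub>F p in nhds (\<alpha>, l). \<forall>w. const_window (win (fst p) n (snd p) w)"
    using regular_orbit_stable(2)[of \<alpha> n l] l(2) const by (auto simp: returns_def elim!: eventually_mono)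
  moreover have "0 < l" "l < 1" using l(1) by (auto simp: d_def)
  ultimately have "sync_point \<alpha> l" unfolding sync_point_def by blast
  then show ?thesis using l(1) by (auto simp: d_def)
qed

end

section \<open>Synchronising points are dense\<close>

context multinacci_base
begin

lemma beta_square_ge: "real q * (\<beta> + 1) \<le> \<beta>\<^sup>2"
proof -
  obtain k where k: "m = Suc (Suc k)" using m2 by (intro that[of "m - 2"]) simp
  have "\<beta> ^ m = (\<Sum>i<m. real q * \<beta> ^ i)" using root by (simp add: is_multinacci_def)
  also have "\<dots> = (\<Sum>i<k. real q * \<beta> ^ i) + real q * \<beta> ^ k + real q * \<beta> ^ Suc k" using k by simp
  finally have "\<beta>\<^sup>2 * \<beta> ^ k = (\<Sum>i<k. real q * \<beta> ^ i) + (real q * (\<beta> + 1)) * \<beta> ^ k"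
    using k by (simp add: power2_eq_square algebra_simps)
  moreover have "0 \<le> (\<Sum>i<k. real q * \<beta> ^ i)" using beta_pos by (intro sum_nonneg) auto
  ultimately have "(real q * (\<beta> + 1)) * \<beta> ^ k \<le> \<beta>\<^sup>2 * \<beta> ^ k" by simp
  then show ?thesis using beta_pos by (simp add: mult_le_cancel_right)
qed

text \<open>
  The exceptional case is the golden mean, for which the estimate in the gap argument below is an
  equality.
\<close>

lemma beta_square: "\<beta> + 1 < \<beta>\<^sup>2 \<or> (\<beta>\<^sup>2 = \<beta> + 1 \<and> q = 1)"
proof -
  note le = beta_square_ge
  have "real q = 1 \<or> 2 \<le> real q" using q1 by auto
  then show ?thesis
  proof
    assume "2 \<le> real q"
    then have "2 * (\<beta> + 1) \<le> real q * (\<beta> + 1)" using beta_pos by (intro mult_right_mono) auto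
    then show ?thesis using le beta_pos by simp
  qed (use le in auto)
qed

lemma floor_range:
  assumes "0 \<le> \<alpha>" "\<alpha> < 1" "0 \<le> x" "x \<le> 1"
  shows "0 \<le> \<lfloor>\<beta> * x + \<alpha>\<rfloor>" "\<lfloor>\<beta> * x + \<alpha>\<rfloor> \<le> int q + 1"
proof -
  have "0 \<le> \<beta> * x + \<alpha>" using assms beta_pos by simp
  then show "0 \<le> \<lfloor>\<beta> * x + \<alpha>\<rfloor>" by simp
  have "\<beta> * x \<le> \<beta> * 1" using assms beta_pos by (intro mult_left_mono) auto
  then have "\<beta> * x + \<alpha> < of_int (int q + 2)" using assms beta_lt by simp
  then show "\<lfloor>\<beta> * x + \<alpha>\<rfloor> \<le> int q + 1" by linarith
qed

end

text \<open>
  The density argument uses only that \<open>G\<close> accumulates at the fixed point \<open>z > \<alpha>\<close> and contains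
  its regular preimages.
\<close>

locale gap_setting = multinacci_base +
  fixes \<alpha> :: real and z :: real and G :: "real set"
  assumes al: "eps < \<alpha>" "\<alpha> < real q / \<beta>"
    and z: "\<beta> * z + \<alpha> = real q + z"
    and near: "\<And>\<delta>. 0 < \<delta> \<Longrightarrow> \<exists>h\<in>G. \<bar>h - z\<bar> < \<delta>"
    and pullback: "\<And>h. 0 < h \<Longrightarrow> h < 1 \<Longrightarrow> \<beta> * h + \<alpha> \<notin> \<int> \<Longrightarrow> T \<beta> \<alpha> h \<in> G \<Longrightarrow> h \<in> G"
begin

text \<open>
  Degenerate gaps are included so that the pairs of end points form a compact set.
\<close>

definition gap :: "real \<Rightarrow> real \<Rightarrow> bool" where
  "gap a b \<longleftrightarrow> 0 \<le> a \<and> a \<le> b \<and> b \<le> 1 \<and> (\<forall>h. a < h \<longrightarrow> h < b \<longrightarrow> h \<notin> G)"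

lemma al01: "0 < \<alpha>" "\<alpha> < 1"
proof -
  show "0 < \<alpha>" using al eps_pos by linarith
  have "real q / \<beta> < 1" using beta_gt_q beta_pos by simp
  then show "\<alpha> < 1" using al by linarith
qed

lemma z_bounds: "\<alpha> < z" "z < 1"
proof -
  have zz: "(\<beta> - 1) * z = real q - \<alpha>" using z by (simp add: algebra_simps)
  have "\<beta> * \<alpha> < real q" using al beta_pos by (simp add: field_simps)
  then have "(\<beta> - 1) * \<alpha> < (\<beta> - 1) * z" unfolding zz by (simp add: algebra_simps)
  then show "\<alpha> < z" by (rule mult_left_less_imp_less) (use beta_gt_1 in simp)
  have "(\<beta> - 1) * z < (\<beta> - 1) * 1" unfolding zz using al by (simp add: eps_def)
  then show "z < 1" by (rule mult_left_less_imp_less) (use beta_gt_1 in simp)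
qed

lemma z_not_in_gap: "gap a b \<Longrightarrow> a < z \<Longrightarrow> z < b \<Longrightarrow> False"
  using near[of "min (z - a) (b - z)"] by (fastforce simp: gap_def)

lemma gap_image:
  assumes g: "gap a b" and f: "of_int n \<le> \<beta> * a + \<alpha>" "\<beta> * b + \<alpha> \<le> of_int n + 1"
  shows "gap (\<beta> * a + \<alpha> - of_int n) (\<beta> * b + \<alpha> - of_int n)"
  unfolding gap_def
proof (intro conjI allI impI)
  show "0 \<le> \<beta> * a + \<alpha> - of_int n" "\<beta> * b + \<alpha> - of_int n \<le> 1" using f by auto
  show "\<beta> * a + \<alpha> - of_int n \<le> \<beta> * b + \<alpha> - of_int n" using g beta_pos by (simp add: gap_def)
  fix k assume k: "\<beta> * a + \<alpha> - of_int n < k" "k < \<beta> * b + \<alpha> - of_int n"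
  define h where "h = (k + of_int n - \<alpha>) / \<beta>"
  have h: "\<beta> * h + \<alpha> = k + of_int n" using beta_pos by (simp add: h_def)
  have "\<beta> * a < \<beta> * h" "\<beta> * h < \<beta> * b" using k h by linarith+
  then have ab: "a < h" "h < b" using beta_pos by simp_all
  have k01: "0 < k" "k < 1" using k f by linarith+
  have "\<lfloor>\<beta> * h + \<alpha>\<rfloor> = n" using h k01 by (simp add: floor_eq_iff)
  then have T: "T \<beta> \<alpha> h = k" using h by (simp add: T_def)
  have "\<beta> * h + \<alpha> \<notin> \<int>"
  proof
    assume "\<beta> * h + \<alpha> \<in> \<int>"
    then have "frac (\<beta> * h + \<alpha>) = 0" by (simp add: frac_eq_0_iff)
    then show False using T k01 unfolding T_frac by simp
  qed
  then show "k \<notin> G" using pullback[of h] T g ab by (auto simp: gap_def)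
qed

lemma gap_sub: "gap a b \<Longrightarrow> a \<le> a' \<Longrightarrow> a' \<le> b' \<Longrightarrow> b' \<le> b \<Longrightarrow> gap a' b'"
  by (auto simp: gap_def)

lemma longest_gap:
  assumes "gap a0 b0" "a0 < b0"
  obtains a b where "gap a b" "a < b" "\<And>a' b'. gap a' b' \<Longrightarrow> b' - a' \<le> b - a"
proof -
  define P where "P = {p :: real \<times> real. gap (fst p) (snd p)}"
  have "closed P"
  proof -
    have "P = {p. 0 \<le> fst p} \<inter> {p. fst p \<le> snd p} \<inter> {p. snd p \<le> 1} \<inter>
        (\<Inter>h\<in>G. {p. h \<le> fst p} \<union> {p. snd p \<le> h})"
      by (auto simp: P_def gap_def not_less[symmetric])
    moreover have "closed \<dots>"
      by (intro closed_Int closed_INT ballI closed_Un closed_Collect_le continuous_intros)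
    ultimately show ?thesis by simp
  qed
  moreover have "bounded P"
    by (rule bounded_subset[OF bounded_Times[OF bounded_closed_interval bounded_closed_interval, of 0 1 0 1]])
      (auto simp: P_def gap_def)
  ultimately have "compact P" by (simp add: compact_eq_bounded_closed)
  moreover have "P \<noteq> {}" using assms by (auto simp: P_def)
  moreover have "continuous_on P (\<lambda>p. snd p - fst p)" by (intro continuous_intros)
  ultimately obtain p where p: "p \<in> P" "\<And>r. r \<in> P \<Longrightarrow> snd r - fst r \<le> snd p - fst p"
    using continuous_attains_sup by (metis (no_types, lifting))
  show ?thesis
  proof (rule that[of "fst p" "snd p"])
    show "gap (fst p) (snd p)" using p by (simp add: P_def)
    show "b' - a' \<le> snd p - fst p" if "gap a' b'" for a' b'
      using p(2)[of "(a', b')"] that by (simp add: P_def)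
    then show "fst p < snd p" using assms by fastforce
  qed
qed

text \<open>
  The image of a longest gap cannot be a gap, so it is cut by a discontinuity \<open>n\<close>; two discontinuities
  would produce the gap from \<open>0\<close> to \<open>1\<close>. The right part of the image is a gap at \<open>0\<close>. If the latter contained
  the first discontinuity, the interval from \<open>\<alpha>\<close> to \<open>1\<close> would be a gap, although \<open>z\<close> lies in it; hence
  it has a full image, and this bounds its length.
\<close>

lemma longest_gap_splits:
  assumes g: "gap a b" "a < b" and max: "\<And>a' b'. gap a' b' \<Longrightarrow> b' - a' \<le> b - a"
  obtains n :: int where "\<beta> * a + \<alpha> < of_int n" "of_int n < \<beta> * b + \<alpha>"
    "gap (\<beta> * a + \<alpha> - of_int n + 1) 1" "gap 0 (\<beta> * b + \<alpha> - of_int n)"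
    "\<beta> * b + \<alpha> - of_int n \<le> (b - a) / \<beta>"
proof -
  define N where "N = \<lfloor>\<beta> * a + \<alpha>\<rfloor>"
  have Na: "of_int N \<le> \<beta> * a + \<alpha>" "\<beta> * a + \<alpha> < of_int N + 1" unfolding N_def by linarith+
  have grow: "b - a < \<beta> * (b - a)" using g beta_gt_1 by simp
  have b: "of_int N + 1 < \<beta> * b + \<alpha>"
  proof (rule ccontr)
    assume "\<not> ?thesis"
    then have "gap (\<beta> * a + \<alpha> - of_int N) (\<beta> * b + \<alpha> - of_int N)"
      using gap_image[OF g(1) Na(1)] by simp
    from max[OF this] grow show False by (simp add: algebra_simps)
  qed
  define n where "n = N + 1"
  have n: "\<beta> * a + \<alpha> < of_int n" "of_int n < \<beta> * b + \<alpha>" using Na b by (auto simp: n_def)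
  define d where "d = (of_int n - \<alpha>) / \<beta>"
  have d: "\<beta> * d + \<alpha> = of_int n" using beta_pos by (simp add: d_def)
  have "\<beta> * a < \<beta> * d" "\<beta> * d < \<beta> * b" using n d by linarith+
  then have dab: "a < d" "d < b" using beta_pos by simp_all
  have left: "gap (\<beta> * a + \<alpha> - of_int N) (\<beta> * d + \<alpha> - of_int N)"
    by (rule gap_image) (use gap_sub[OF g(1), of a d] dab Na d n_def in auto)
  have b2: "\<beta> * b + \<alpha> \<le> of_int n + 1"
  proof (rule ccontr)
    assume c: "\<not> ?thesis"
    define e where "e = (of_int n + 1 - \<alpha>) / \<beta>"
    have e: "\<beta> * e + \<alpha> = of_int n + 1" using beta_pos by (simp add: e_def)
    have "\<beta> * d < \<beta> * e" "\<beta> * e < \<beta> * b" using c d e by linarith+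
    then have de: "d < e" "e < b" using beta_pos by simp_all
    have "gap (\<beta> * d + \<alpha> - of_int n) (\<beta> * e + \<alpha> - of_int n)"
      by (rule gap_image) (use gap_sub[OF g(1), of d e] dab de d e in auto)
    then have "gap 0 1" using d e by simp
    then show False using z_not_in_gap[of 0 1] z_bounds al01 by simp
  qed
  have right: "gap (\<beta> * d + \<alpha> - of_int n) (\<beta> * b + \<alpha> - of_int n)"
    by (rule gap_image) (use gap_sub[OF g(1), of d b] dab d b2 in auto)
  define r where "r = \<beta> * b + \<alpha> - of_int n"
  have r: "gap 0 r" "0 < r" using right d n by (auto simp: r_def)
  have "r \<le> (b - a) / \<beta>"
  proof (cases "\<beta> * r + \<alpha> \<le> 1")
    case True
    have "gap (\<beta> * 0 + \<alpha> - of_int 0) (\<beta> * r + \<alpha> - of_int 0)"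
      by (rule gap_image[OF r(1)]) (use True al01 in auto)
    from max[OF this] show ?thesis using beta_pos by (simp add: field_simps)
  next
    case False
    define e where "e = (1 - \<alpha>) / \<beta>"
    have e: "\<beta> * e + \<alpha> = 1" using beta_pos by (simp add: e_def)
    have "\<beta> * e < \<beta> * r" using e False by linarith
    then have "e < r" using beta_pos by simp
    have "0 \<le> e" using al01 beta_pos by (simp add: e_def)
    have "gap (\<beta> * 0 + \<alpha> - of_int 0) (\<beta> * e + \<alpha> - of_int 0)"
      by (rule gap_image) (use gap_sub[OF r(1), of 0 e] \<open>e < r\<close> \<open>0 \<le> e\<close> e al01 in auto)
    then have "gap \<alpha> 1" using e by simp
    then show ?thesis using z_not_in_gap z_bounds by blast
  qed
  moreover have "\<beta> * a + \<alpha> - of_int N = \<beta> * a + \<alpha> - of_int n + 1" "\<beta> * d + \<alpha> - of_int N = 1"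
    using d by (simp_all add: n_def)
  then have "gap (\<beta> * a + \<alpha> - of_int n + 1) 1" using left by (simp only:)
  ultimately show ?thesis using that[of n] n r by (simp add: r_def)
qed

text \<open>
  The two parts of the image have total length \<open>\<beta> * \<gamma>\<close> but at most \<open>\<gamma> / \<beta> + \<gamma>\<close>, where \<open>\<gamma>\<close> is the
  maximal length. This excludes all \<open>\<beta>\<close> with \<open>\<beta>\<^sup>2 > \<beta> + 1\<close>. For the golden mean all estimates are
  equalities, which determines successively the longest gaps from \<open>1 - \<gamma>\<close> to \<open>1\<close> and from \<open>\<alpha>\<close> to
  \<open>\<alpha> + \<gamma>\<close>; comparing end points forces \<open>\<alpha> = eps\<close> or \<open>\<alpha> = 1 / \<beta>\<close>, both excluded.
\<close>

lemma no_gap: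
  assumes "gap a0 b0" "a0 < b0" shows False
proof -
  obtain a b where g: "gap a b" "a < b" and max: "\<And>a' b'. gap a' b' \<Longrightarrow> b' - a' \<le> b - a"
    using longest_gap[OF assms] by blast
  define \<gamma> where "\<gamma> = b - a"
  have \<gamma>: "0 < \<gamma>" using g by (simp add: \<gamma>_def)
  obtain n :: int where n: "\<beta> * a + \<alpha> < of_int n" "of_int n < \<beta> * b + \<alpha>"
    "gap (\<beta> * a + \<alpha> - of_int n + 1) 1" "gap 0 (\<beta> * b + \<alpha> - of_int n)"
    "\<beta> * b + \<alpha> - of_int n \<le> (b - a) / \<beta>"
    using longest_gap_splits[OF g max] by blast
  have l: "of_int n - (\<beta> * a + \<alpha>) \<le> \<gamma>" using max[OF n(3)] by (simp add: \<gamma>_def)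
  have tot: "(\<beta> * b + \<alpha> - of_int n) + (of_int n - (\<beta> * a + \<alpha>)) = \<beta> * \<gamma>"
    by (simp add: \<gamma>_def algebra_simps)
  have "\<beta> * \<gamma> \<le> \<gamma> / \<beta> + \<gamma>" using tot l n(5) by (simp add: \<gamma>_def)
  then have "\<beta> * (\<beta> * \<gamma>) \<le> \<beta> * (\<gamma> / \<beta> + \<gamma>)" using beta_pos by (intro mult_left_mono) auto
  then have "\<beta>\<^sup>2 * \<gamma> \<le> (1 + \<beta>) * \<gamma>" using beta_pos by (simp add: power2_eq_square algebra_simps)
  then have "\<beta>\<^sup>2 \<le> \<beta> + 1" using \<gamma> by simp
  then have sq: "\<beta>\<^sup>2 = \<beta> + 1" and q: "q = 1" using beta_square by auto
  have "\<gamma> * (\<beta> - 1) * \<beta> = \<gamma> * (\<beta>\<^sup>2 - \<beta>)" by (simp add: power2_eq_square algebra_simps)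
  then have gb: "\<gamma> / \<beta> = \<gamma> * (\<beta> - 1)"
    using sq beta_pos by (simp add: divide_eq_eq)
  \<comment> \<open>for the golden mean, \<open>\<gamma> / \<beta> + \<gamma> = \<beta> * \<gamma>\<close>, so the bounds on the two parts are attained\<close>
  have exact: "v = \<gamma> * (\<beta> - 1)" "u = \<gamma>" if "v \<le> \<gamma> / \<beta>" "u \<le> \<gamma>" "v + u = \<beta> * \<gamma>" for u v
    using that gb by (auto simp: algebra_simps)
  have "of_int n - (\<beta> * a + \<alpha>) = \<gamma>"
    by (rule exact(2)[OF n(5)[folded \<gamma>_def] l tot])
  then have g1: "gap (1 - \<gamma>) 1" using n(3) by (simp add: algebra_simps)
  have eps: "eps = 2 - \<beta>" unfolding eps_def using q by simp
  obtain n1 :: int where n1: "\<beta> * (1 - \<gamma>) + \<alpha> < of_int n1" "of_int n1 < \<beta> * 1 + \<alpha>"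
    "gap (\<beta> * (1 - \<gamma>) + \<alpha> - of_int n1 + 1) 1" "gap 0 (\<beta> * 1 + \<alpha> - of_int n1)"
    "\<beta> * 1 + \<alpha> - of_int n1 \<le> (1 - (1 - \<gamma>)) / \<beta>"
    using longest_gap_splits[OF g1] \<gamma> max by (auto simp: \<gamma>_def)
  have l1: "of_int n1 - (\<beta> * (1 - \<gamma>) + \<alpha>) \<le> \<gamma>" using max[OF n1(3)] by (simp add: \<gamma>_def)
  have v1: "\<beta> * 1 + \<alpha> - of_int n1 = \<gamma> * (\<beta> - 1)"
    by (rule exact(1)[of _ "of_int n1 - (\<beta> * (1 - \<gamma>) + \<alpha>)"]) (use n1(5) l1 in \<open>auto simp: algebra_simps\<close>)
  have \<gamma>1: "\<gamma> \<le> 1" using g by (simp add: gap_def \<gamma>_def)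
  have "real_of_int n1 = 2"
  proof -
    have "\<beta> * 1 + \<alpha> - of_int n1 < 1"
    proof -
      have "\<gamma> * (\<beta> - 1) \<le> 1 * (\<beta> - 1)" using \<gamma>1 beta_gt_1 by (intro mult_right_mono) auto
      then show ?thesis using v1 beta_lt q by simp
    qed
    then have "\<beta> + \<alpha> - 1 < of_int n1" by simp
    moreover have "1 < \<beta> + \<alpha> - 1" using al eps by simp
    moreover have "real_of_int n1 < 3" using n1(2) beta_lt al01 q by simp
    ultimately have "1 < real_of_int n1" "real_of_int n1 < 3" by linarith+
    then have "1 < n1" "n1 < 3" by linarith+
    then show ?thesis by simp
  qed
  then have v: "\<alpha> - eps = \<gamma> * (\<beta> - 1)" using v1 eps by simp
  have "\<beta> * 1 + \<alpha> - of_int n1 = \<alpha> - eps" using \<open>real_of_int n1 = 2\<close> eps by simp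
  then have "gap 0 (\<alpha> - eps)" using n1(4) by (simp only:)
  have bv: "\<beta> * (\<alpha> - eps) = \<gamma>"
  proof -
    have "\<beta> * (\<alpha> - eps) = \<gamma> * (\<beta>\<^sup>2 - \<beta>)" unfolding v by (simp add: power2_eq_square algebra_simps)
    then show ?thesis using sq by simp
  qed
  have "\<alpha> + \<gamma> \<le> 1"
  proof (rule ccontr)
    assume c: "\<not> ?thesis"
    define e where "e = (1 - \<alpha>) / \<beta>"
    have e: "\<beta> * e + \<alpha> = 1" using beta_pos by (simp add: e_def)
    have "\<beta> * e < \<beta> * (\<alpha> - eps)" using e c bv by linarith
    then have "e < \<alpha> - eps" using beta_pos by simp
    have "0 \<le> e" using al01 beta_pos by (simp add: e_def)
    have "gap (\<beta> * 0 + \<alpha> - of_int 0) (\<beta> * e + \<alpha> - of_int 0)"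
      by (rule gap_image) (use gap_sub[OF \<open>gap 0 (\<alpha> - eps)\<close>, of 0 e] \<open>e < \<alpha> - eps\<close> \<open>0 \<le> e\<close> e al01 in auto)
    then have "gap \<alpha> 1" using e by simp
    then show False using z_not_in_gap z_bounds by blast
  qed
  then have g2: "gap \<alpha> (\<alpha> + \<gamma>)"
    using gap_image[OF \<open>gap 0 (\<alpha> - eps)\<close>, of 0] bv al01 by (simp add: add.commute)
  obtain n2 :: int where n2: "\<beta> * \<alpha> + \<alpha> < of_int n2" "of_int n2 < \<beta> * (\<alpha> + \<gamma>) + \<alpha>"
    "gap (\<beta> * \<alpha> + \<alpha> - of_int n2 + 1) 1" "gap 0 (\<beta> * (\<alpha> + \<gamma>) + \<alpha> - of_int n2)"
    "\<beta> * (\<alpha> + \<gamma>) + \<alpha> - of_int n2 \<le> (\<alpha> + \<gamma> - \<alpha>) / \<beta>"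
    using longest_gap_splits[OF g2] \<gamma> max by (auto simp: \<gamma>_def)
  have l2: "of_int n2 - (\<beta> * \<alpha> + \<alpha>) \<le> \<gamma>" using max[OF n2(3)] by (simp add: \<gamma>_def)
  have "of_int n2 - (\<beta> * \<alpha> + \<alpha>) = \<gamma>"
    by (rule exact(2)[of "\<beta> * (\<alpha> + \<gamma>) + \<alpha> - of_int n2"]) (use n2(5) l2 in \<open>auto simp: algebra_simps\<close>)
  then have key: "(2 * \<beta> + 1) * \<alpha> = of_int n2 + \<beta> * eps"
    using bv by (simp add: algebra_simps)
  have be: "\<beta> * eps = \<beta> - 1" unfolding eps using sq by (simp add: power2_eq_square algebra_simps)
  have lo: "(2 * \<beta> + 1) * eps < (2 * \<beta> + 1) * \<alpha>" using al beta_pos by simp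
  have e1: "(2 * \<beta> + 1) * eps = \<beta>" unfolding eps using sq by (simp add: power2_eq_square algebra_simps)
  have "\<beta> * \<alpha> < 1" using al beta_pos q by (simp add: field_simps)
  moreover have "\<alpha> < \<beta> - 1"
  proof -
    have "\<alpha> * \<beta> < (\<beta> - 1) * \<beta>" using \<open>\<beta> * \<alpha> < 1\<close> sq by (simp add: power2_eq_square algebra_simps)
    then show ?thesis using beta_pos by (simp add: mult_less_cancel_right)
  qed
  ultimately have hi: "(2 * \<beta> + 1) * \<alpha> < \<beta> + 1" by (simp add: algebra_simps)
  have "1 < real_of_int n2" "real_of_int n2 < 2" using lo hi e1 key be by linarith+
  then have "1 < n2" "n2 < 2" by simp_all
  then show False by linarith
qed

lemma dense:
  assumes "0 \<le> a" "a < b" "b \<le> 1" shows "\<exists>h\<in>G. a < h \<and> h < b"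
  using no_gap[of a b] assms by (auto simp: gap_def)

end

section \<open>Porous sets and the breakpoints in the parameter\<close>

text \<open>
  By Vitali's theorem the set is covered, up to a null set, by disjoint balls inside an almost optimal
  open superset, and each ball contains a hole of relative size \<open>c\<close> that misses the set. If the
  infimum \<open>M\<close> of the measures of supersets were positive, this would give a superset of smaller measure.
\<close>

lemma porous_negligible_bounded:
  fixes S :: "real set"
  assumes c: "0 < c" and bdd: "bounded S"
    and por: "\<And>x d. x \<in> S \<Longrightarrow> 0 < d \<Longrightarrow>
      \<exists>r y. 0 < r \<and> r < d \<and> ball y (c * r) \<subseteq> ball x r \<and> ball y (c * r) \<inter> S = {}"
  shows "negligible S"
proof -
  define A where "A = {measure lebesgue V |V. V \<in> lmeasurable \<and> S \<subseteq> V}"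
  define M where "M = Inf A"
  obtain a where "S \<subseteq> cbox (- a) a" using bounded_subset_cbox_symmetric[OF bdd] by blast
  then have ne: "A \<noteq> {}" unfolding A_def using lmeasurable_cbox by blast
  have bb: "bdd_below A" by (rule bdd_belowI[of _ 0]) (auto simp: A_def)
  have M0: "0 \<le> M" unfolding M_def by (rule cInf_greatest[OF ne]) (auto simp: A_def)
  have "M = 0"
  proof (rule ccontr)
    assume "M \<noteq> 0"
    then have M: "0 < M" using M0 by simp
    \<comment> \<open>small enough for \<open>(1 - c) * (M + 2 * e) < M\<close>\<close>
    define e where "e = c * M / 4"
    have e: "0 < e" using c M by (simp add: e_def)
    have "\<exists>v\<in>A. v < M + e" using cInf_lessD[OF ne, of "M + e"] e by (auto simp: M_def)
    then obtain V where V: "V \<in> lmeasurable" "S \<subseteq> V" "measure lebesgue V < M + e" by (auto simp: A_def)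
    obtain U where U: "open U" "V \<subseteq> U" "U - V \<in> lmeasurable" "emeasure lebesgue (U - V) < ennreal e"
      using sets_lebesgue_outer_open[of V e] V(1) e by (auto simp: fmeasurableD)
    have UV: "U = V \<union> (U - V)" using U by blast
    have Um: "U \<in> lmeasurable" using UV V(1) U(3) by (metis fmeasurable.Un)
    have "measure lebesgue (U - V) < e"
      using U(3,4) e by (simp add: emeasure_eq_measure2 ennreal_less_iff)
    moreover have "measure lebesgue U \<le> measure lebesgue V + measure lebesgue (U - V)"
      using measure_Un_le[of V lebesgue "U - V"] UV V(1) U(3) by (metis fmeasurableD)
    ultimately have mU: "measure lebesgue U < M + 2 * e" using V(3) by simp
    define K where "K = {(x, r, y). 0 < r \<and> ball x r \<subseteq> U \<and> ball y (c * r) \<subseteq> ball x r \<and> ball y (c * r) \<inter> S = {}}"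
    define ctr where "ctr = (\<lambda>i :: real \<times> real \<times> real. fst i)"
    define rad where "rad = (\<lambda>i :: real \<times> real \<times> real. fst (snd i))"
    define hol where "hol = (\<lambda>i :: real \<times> real \<times> real. snd (snd i))"
    obtain C where C: "countable C" "C \<subseteq> K"
      "pairwise (\<lambda>i j. disjnt (ball (ctr i) (rad i)) (ball (ctr j) (rad j))) C"
      "negligible (S - (\<Union>i\<in>C. ball (ctr i) (rad i)))"
    proof (rule Vitali_covering_theorem_balls[of S K ctr rad])
      fix x d :: real assume x: "x \<in> S" "0 < d"
      then have "x \<in> U" using V(2) U(2) by blast
      then obtain k where k: "0 < k" "ball x k \<subseteq> U" using U(1) open_contains_ball by blast
      obtain r y where r: "0 < r" "r < min d k" "ball y (c * r) \<subseteq> ball x r" "ball y (c * r) \<inter> S = {}"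
        using por[OF x(1), of "min d k"] x k by auto
      have "ball x r \<subseteq> U" using k r by (meson min.strict_boundedE order.trans less_imp_le subset_ball)
      then have "(x, r, y) \<in> K" using r by (simp add: K_def)
      then show "\<exists>i. i \<in> K \<and> x \<in> ball (ctr i) (rad i) \<and> rad i < d"
        using r by (intro exI[of _ "(x, r, y)"]) (simp add: ctr_def rad_def)
    qed
    have CK: "0 < rad i" "ball (ctr i) (rad i) \<subseteq> U" "ball (hol i) (c * rad i) \<subseteq> ball (ctr i) (rad i)"
      "ball (hol i) (c * rad i) \<inter> S = {}" if "i \<in> C" for i
      using subsetD[OF C(2) that] by (cases i; simp add: K_def ctr_def rad_def hol_def)+
    define W where "W = (\<Union>i\<in>C. ball (ctr i) (rad i))"
    define P where "P = (\<Union>i\<in>C. ball (hol i) (c * rad i))"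
    have dW: "disjoint_family_on (\<lambda>i. ball (ctr i) (rad i)) C"
      using C(3) by (auto simp: disjoint_family_on_def pairwise_def disjnt_def)
    have dP: "disjoint_family_on (\<lambda>i. ball (hol i) (c * rad i)) C"
      using dW CK(3) unfolding disjoint_family_on_def by (meson disjoint_iff subsetD)
    have WU: "W \<subseteq> U" using CK(2) by (auto simp: W_def)
    have PW: "P \<subseteq> W" unfolding P_def W_def using CK(3) by blast
    have PS: "P \<inter> S = {}" unfolding P_def using CK(4) by blast
    have Wm: "W \<in> lmeasurable"
      by (rule fmeasurableI2[OF Um WU]) (simp add: W_def borel_open open_UN)
    have Pm: "P \<in> lmeasurable"
      by (rule fmeasurableI2[OF Wm PW]) (simp add: P_def borel_open open_UN)
    have ball_em: "emeasure lborel (ball x r) = ennreal (2 * r)" if "0 < r" for x r :: real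
      using that by (simp add: ball_eq_greaterThanLessThan)
    have "emeasure lborel P = (\<integral>\<^sup>+i. emeasure lborel (ball (hol i) (c * rad i)) \<partial>count_space C)"
      unfolding P_def by (rule emeasure_UN_countable[OF _ C(1) dP]) simp
    also have "\<dots> = (\<integral>\<^sup>+i. ennreal c * emeasure lborel (ball (ctr i) (rad i)) \<partial>count_space C)"
    proof (rule nn_integral_cong)
      fix i assume "i \<in> space (count_space C)"
      then have "0 < rad i" "0 < c * rad i" using CK(1)[of i] c by simp_all
      then show "emeasure lborel (ball (hol i) (c * rad i)) = ennreal c * emeasure lborel (ball (ctr i) (rad i))"
        using c by (simp add: ball_em ennreal_mult[symmetric] mult_ac)
    qed
    also have "\<dots> = ennreal c * (\<integral>\<^sup>+i. emeasure lborel (ball (ctr i) (rad i)) \<partial>count_space C)"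
      by (rule nn_integral_cmult) simp
    also have "(\<integral>\<^sup>+i. emeasure lborel (ball (ctr i) (rad i)) \<partial>count_space C) = emeasure lborel W"
      unfolding W_def by (rule emeasure_UN_countable[OF _ C(1) dW, symmetric]) simp
    finally have "emeasure lebesgue P = ennreal c * emeasure lebesgue W"
      by (simp add: P_def W_def borel_open open_UN)
    then have "ennreal (measure lebesgue P) = ennreal (c * measure lebesgue W)"
      using Pm Wm c by (simp add: emeasure_eq_measure2 ennreal_mult)
    then have mP: "measure lebesgue P = c * measure lebesgue W" using c by simp
    define Z where "Z = S - W"
    have Z: "negligible Z" using C(4) by (simp add: Z_def W_def)
    have "S \<subseteq> (W - P) \<union> Z" using PS by (auto simp: Z_def)
    moreover have Tm: "(W - P) \<union> Z \<in> lmeasurable"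
      using Wm Pm Z by (intro fmeasurable.Un fmeasurable.Diff) (auto simp: negligible_imp_measurable fmeasurableD)
    ultimately have "M \<le> measure lebesgue ((W - P) \<union> Z)"
      unfolding M_def by (intro cInf_lower bb) (auto simp: A_def)
    also have "\<dots> \<le> measure lebesgue (W - P) + measure lebesgue Z"
      using Wm Pm Z by (intro measure_Un_le) (auto simp: negligible_imp_sets fmeasurableD)
    also have "\<dots> = measure lebesgue (W - P)" using Z by (simp add: negligible_imp_measure0)
    also have "\<dots> = (1 - c) * measure lebesgue W"
      using measurable_measure_Diff[OF Wm _ PW] Pm mP by (simp add: fmeasurableD algebra_simps)
    finally have M1: "M \<le> (1 - c) * measure lebesgue W" .
    have "0 < 1 - c" using M M1 by (metis less_eq_real_def measure_nonneg mult_nonpos_nonneg not_less order_trans)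
    moreover have "measure lebesgue W \<le> measure lebesgue U"
      using WU Um Wm by (intro measure_mono_fmeasurable) (auto simp: fmeasurableD)
    ultimately have "M \<le> (1 - c) * (M + 2 * e)"
      using M1 mU by (smt (verit) mult_left_mono)
    also have "\<dots> = M - M * c * (1 / 2 + c / 2)" by (simp add: e_def field_simps)
    also have "\<dots> < M" using M c by simp
    finally show False by simp
  qed
  show ?thesis
    unfolding negligible_outer
  proof (intro allI impI)
    fix e :: real assume "0 < e"
    then obtain v where "v \<in> A" "v < e" using cInf_lessD[OF ne, of e] \<open>M = 0\<close> by (auto simp: M_def)
    then show "\<exists>V. S \<subseteq> V \<and> V \<in> lmeasurable \<and> measure lebesgue V < e" by (auto simp: A_def)
  qed
qed

context multinacci_base
begin

text \<open>
  The derivative of \<open>T ^ k 1\<close> with respect to \<open>\<alpha>\<close>.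
\<close>

definition slope :: "nat \<Rightarrow> real" where "slope k = (\<Sum>i<k. \<beta> ^ i)"

lemma slope_0: "slope 0 = 0" by (simp add: slope_def)

lemma slope_Suc: "slope (Suc k) = \<beta> * slope k + 1"
  unfolding slope_def by (subst sum.lessThan_Suc_shift) (simp add: sum_distrib_left)

lemma slope_nonneg: "0 \<le> slope k" unfolding slope_def using beta_pos by (intro sum_nonneg) simp

lemma slope_ge: "real k \<le> slope k"
proof (induction k)
  case (Suc k)
  have "1 * slope k \<le> \<beta> * slope k" using beta_gt_1 slope_nonneg by (intro mult_right_mono) auto
  then show ?case using Suc by (simp add: slope_Suc)
qed (simp add: slope_0)

lemma sum_slope: "(\<Sum>j<k. slope (Suc j)) \<le> \<beta> / (\<beta> - 1) * slope k"
proof (induction k)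
  case (Suc k)
  have "\<beta> / (\<beta> - 1) * slope k \<le> 1 / (\<beta> - 1) * slope (Suc k)"
    using beta_gt_1 by (simp add: slope_Suc divide_right_mono)
  moreover have "1 / (\<beta> - 1) * slope (Suc k) + slope (Suc k) = \<beta> / (\<beta> - 1) * slope (Suc k)"
    using beta_gt_1 by (simp add: field_simps)
  ultimately show ?case using Suc by simp
qed (simp add: slope_0)

text \<open>
  This is the integer version of the windows. Any sequence with \<open>t 0 = 0\<close> and
  \<open>t (Suc j) = \<beta> * t j + \<delta> j\<close> for integers \<open>\<delta> j\<close> is the amount by which an integer sequence deviates from the \<open>lam\<close>-weighted mean of its last
  \<open>m\<close> values; the recursion is obtained by solving for the next integer.
\<close>

primrec counters :: "(nat \<Rightarrow> int) \<Rightarrow> nat \<Rightarrow> nat \<Rightarrow> int" where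
  "counters \<delta> 0 = (\<lambda>_. 0)"
| "counters \<delta> (Suc j) = case_nat ((int q + 1) * counters \<delta> j 0 - int q * counters \<delta> j m + \<delta> j) (counters \<delta> j)"

definition defect :: "(nat \<Rightarrow> int) \<Rightarrow> real" where
  "defect g = of_int (g 0) - (\<Sum>i<m. lam i * of_int (g (Suc i)))"

lemma defect_push:
  "defect (case_nat x g) = of_int x - (\<beta> + eps) * of_int (g 0) + real q * of_int (g m) + \<beta> * defect g"
proof -
  obtain k where k: "m = Suc k" using m2 by (cases m) auto
  have k2: "{..<m} = {..<Suc k}" by (simp add: k)
  have "(\<Sum>i<m. lam i * of_int (g i)) = eps * of_int (g 0) + (\<Sum>i<k. lam (Suc i) * of_int (g (Suc i)))"
    by (simp only: k2 sum.lessThan_Suc_shift lam_0)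
  moreover have "\<beta> * (\<Sum>i<m. lam i * of_int (g (Suc i)))
      = (\<Sum>i<k. lam (Suc i) * of_int (g (Suc i))) + \<beta> * lam k * of_int (g (Suc k))"
    by (simp only: k2 sum.lessThan_Suc) (simp add: sum_distrib_left lam_Suc distrib_left mult.assoc)
  moreover have "\<beta> * lam k = real q" using beta_lam_last k by simp
  moreover have "g (Suc k) = g m" using k by simp
  ultimately show ?thesis by (simp add: defect_def algebra_simps)
qed

lemma defect_counters:
  assumes "t 0 = 0" "\<And>j. t (Suc j) = \<beta> * t j + of_int (\<delta> j)"
  shows "t j = defect (counters \<delta> j)"
proof (induction j)
  case 0 show ?case by (simp add: assms defect_def)
next
  case (Suc j)
  have "\<beta> + eps = real q + 1" by (simp add: eps_def)
  then show ?case using assms(2)[of j] Suc by (simp add: defect_push)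
qed

text \<open>
  If \<open>\<bar>t k\<bar> < 1\<close>, then all earlier values are bounded, because going backwards contracts. A sequence
  that deviates from its weighted mean by at most \<open>R\<close> has oscillation at most \<open>R / eps\<close> in each window,
  as every weight is at least \<open>eps\<close>. So \<open>t k\<close> is one of finitely many weighted sums of bounded integers.
\<close>

lemma separation:
  obtains c0 where "0 < c0" "\<And>\<delta> t k. t 0 = 0 \<Longrightarrow> (\<And>j. t (Suc j) = \<beta> * t j + of_int (\<delta> j)) \<Longrightarrow>
     (\<And>j. \<bar>\<delta> j\<bar> \<le> int q + 1) \<Longrightarrow> t k \<noteq> 0 \<Longrightarrow> c0 \<le> \<bar>t k\<bar>"
proof -
  define B where "B = real q + 1"
  define R where "R = B / (\<beta> - 1) + 1"
  define K where "K = R / eps"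
  have R1: "1 \<le> R" using beta_gt_1 by (simp add: R_def B_def)
  have "(\<beta> - 1) * R = B + (\<beta> - 1)" using beta_gt_1 by (simp add: R_def distrib_left)
  then have "R + B \<le> R * \<beta>" using beta_gt_1 by (simp add: algebra_simps)
  then have RB: "(R + B) / \<beta> \<le> R" using beta_pos by (simp add: divide_le_eq)
  have K: "eps * K = R" using eps_pos by (simp add: K_def)
  have K0: "0 \<le> K" using R1 eps_pos by (simp add: K_def)
  define D where "D = (\<Pi>\<^sub>E i\<in>{..<m}. {- \<lceil>K\<rceil>..\<lceil>K\<rceil>})"
  define F where "F = (\<lambda>d. \<bar>\<Sum>i<m. lam i * of_int (d i)\<bar>) ` D"
  have "finite D" unfolding D_def by (intro finite_PiE) auto
  then have finF: "finite F" by (simp add: F_def)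
  define c0 where "c0 = Min (insert 1 (F - {0}))"
  have "0 < c0" unfolding c0_def using finF by (subst Min_gr_iff) (auto simp: F_def)
  moreover have "c0 \<le> \<bar>t k\<bar>"
    if t: "t 0 = 0" "\<And>j. t (Suc j) = \<beta> * t j + of_int (\<delta> j)" "\<And>j. \<bar>\<delta> j\<bar> \<le> int q + 1" "t k \<noteq> 0"
    for \<delta> :: "nat \<Rightarrow> int" and t k
  proof (cases "\<bar>t k\<bar> < 1")
    case False
    then show ?thesis unfolding c0_def using finF by (intro order_trans[OF Min_le[of _ 1]]) auto
  next
    case True
    have bnd: "\<bar>t (k - i)\<bar> \<le> R" if "i \<le> k" for i
      using that
    proof (induction i)
      case 0 then show ?case using True R1 by simp
    next
      case (Suc i)
      then have ki: "k - i = Suc (k - Suc i)" by simp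
      have "\<bar>t (k - i)\<bar> \<le> R" using Suc by simp
      moreover have "\<beta> * t (k - Suc i) = t (k - i) - of_int (\<delta> (k - Suc i))" using t(2)[of "k - Suc i"] ki by simp
      moreover have "\<bar>real_of_int (\<delta> (k - Suc i))\<bar> \<le> B" using t(3)[of "k - Suc i"] by (simp add: B_def)
      ultimately have "\<bar>\<beta> * t (k - Suc i)\<bar> \<le> R + B" by linarith
      then have "\<bar>t (k - Suc i)\<bar> \<le> (R + B) / \<beta>" using beta_pos by (simp add: abs_mult field_simps)
      then show ?case using RB by simp
    qed
    have tb: "\<bar>t j\<bar> \<le> R" if "j \<le> k" for j using bnd[of "k - j"] that by simp
    define g where "g = counters \<delta>"
    have td: "t j = defect (g j)" for j unfolding g_def by (rule defect_counters[OF t(1,2)])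
    have new: "\<bar>of_int (g (Suc j) 0) - of_int (g j i)\<bar> \<le> K"
      if osc: "\<And>i i'. i < m \<Longrightarrow> i' < m \<Longrightarrow> \<bar>real_of_int (g j i) - of_int (g j i')\<bar> \<le> K"
        and j: "Suc j \<le> k" and i: "i < m" for j i
    proof -
      have "t (Suc j) = of_int (g (Suc j) 0) - (\<Sum>l<m. lam l * of_int (g j l))"
        unfolding td defect_def by (simp add: g_def)
      moreover have "(\<Sum>l<m. lam l * of_int (g j i)) = of_int (g j i)"
        using sum_lam by (simp add: sum_distrib_right[symmetric])
      ultimately have e: "of_int (g (Suc j) 0) - of_int (g j i)
          = t (Suc j) + (\<Sum>l<m. lam l * (of_int (g j l) - of_int (g j i)))"
        by (simp add: right_diff_distrib sum_subtractf)
      have "\<bar>\<Sum>l<m. lam l * (of_int (g j l) - of_int (g j i))\<bar>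
          \<le> (\<Sum>l<m. \<bar>lam l * (of_int (g j l) - of_int (g j i))\<bar>)" by (rule sum_abs)
      also have "\<dots> = (\<Sum>l\<in>{..<m} - {i}. \<bar>lam l * (of_int (g j l) - of_int (g j i))\<bar>)"
        using i by (subst sum.remove[of _ i]) auto
      also have "\<dots> \<le> (\<Sum>l\<in>{..<m} - {i}. lam l * K)"
        using osc i lam_pos by (intro sum_mono) (auto simp: abs_mult less_imp_le intro!: mult_left_mono)
      also have "\<dots> = (\<Sum>l\<in>{..<m} - {i}. lam l) * K" by (simp add: sum_distrib_right)
      also have "(\<Sum>l\<in>{..<m} - {i}. lam l) = 1 - lam i"
        using sum_lam sum.remove[of "{..<m}" i lam] i by simp
      also have "(1 - lam i) * K \<le> (1 - eps) * K"
      proof (rule mult_right_mono[OF _ K0])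
        have "1 \<le> \<beta> ^ i" using beta_gt_1 by (simp add: one_le_power)
        then have "eps * 1 \<le> eps * \<beta> ^ i" using eps_pos by (intro mult_left_mono) auto
        then show "1 - lam i \<le> 1 - eps" by (simp add: lam_def)
      qed
      also have "\<dots> = K - R" using K by (simp add: algebra_simps)
      finally show ?thesis unfolding e using tb[OF j] by linarith
    qed
    have osc: "\<bar>real_of_int (g j i) - of_int (g j i')\<bar> \<le> K" if "j \<le> k" "i < m" "i' < m" for j i i'
      using that
    proof (induction j arbitrary: i i')
      case 0 then show ?case using K0 by (simp add: g_def)
    next
      case (Suc j)
      have gS: "g (Suc j) (Suc l) = g j l" for l by (simp add: g_def)
      have n: "\<bar>of_int (g (Suc j) 0) - of_int (g j l)\<bar> \<le> K" if "l < m" for l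
        by (rule new) (use Suc that in auto)
      have IH: "\<bar>real_of_int (g j l) - of_int (g j l')\<bar> \<le> K" if "l < m" "l' < m" for l l'
        by (rule Suc.IH) (use Suc.prems that in auto)
      show ?case
        using n[of "i - 1"] n[of "i' - 1"] IH[of "i - 1" "i' - 1"] K0 Suc.prems
        by (cases i; cases i') (auto simp: gS abs_minus_commute)
    qed
    obtain j where j: "k = Suc j" using t(1,4) by (cases k) auto
    define d where "d = (\<lambda>i\<in>{..<m}. g k 0 - g j i)"
    have tk: "t k = (\<Sum>i<m. lam i * of_int (d i))"
    proof -
      have "t k = (\<Sum>i<m. lam i) * of_int (g k 0) - (\<Sum>i<m. lam i * of_int (g j i))"
        unfolding td defect_def sum_lam j by (simp add: g_def)
      then show ?thesis by (simp add: d_def sum_distrib_right right_diff_distrib sum_subtractf)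
    qed
    have "d \<in> D"
      unfolding D_def
    proof
      fix i assume "i \<in> {..<m}"
      then have "\<bar>of_int (g k 0) - of_int (g j i)\<bar> \<le> K"
        unfolding j by (intro new osc) (use j in auto)
      then show "d i \<in> {- \<lceil>K\<rceil>..\<lceil>K\<rceil>}" using \<open>i \<in> {..<m}\<close> by (simp add: d_def) linarith
    qed (simp add: d_def)
    then have "\<bar>t k\<bar> \<in> F - {0}" using t(4) tk by (auto simp: F_def)
    then show ?thesis unfolding c0_def using finF by (intro Min_le) auto
  qed
  ultimately show ?thesis using that by blast
qed

text \<open>
  The breakpoints, as a function of \<open>\<alpha>\<close>, that appear in \<open>T ^ Suc k 1\<close>.
\<close>

definition cuts :: "nat \<Rightarrow> real set" where
  "cuts k = {\<alpha>. 0 \<le> \<alpha> \<and> \<alpha> < 1 \<and> (T \<beta> \<alpha> ^^ Suc k) 1 = 0}"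

lemma cuts_iff:
  assumes "0 \<le> \<alpha>" "\<alpha> < 1"
  shows "\<alpha> \<in> cuts k \<longleftrightarrow> \<beta> * (T \<beta> \<alpha> ^^ k) 1 + \<alpha> \<in> \<int>"
  using assms by (simp add: cuts_def T_frac frac_eq_0_iff)

lemma orbit_bounds: "0 \<le> (T \<beta> \<alpha> ^^ k) 1" "(T \<beta> \<alpha> ^^ k) 1 \<le> 1"
  using T_in[of \<alpha>] by (cases k; simp add: less_imp_le)+

text \<open>
  At two breakpoints of the same level the orbits of \<open>1\<close> end in \<open>0\<close>, so \<open>slope (Suc k)\<close> times the
  difference of the parameters is a sum to which \<open>separation\<close> applies.
\<close>

lemma cuts_separated:
  obtains c0 where "0 < c0"
    "\<And>k a b. a \<in> cuts k \<Longrightarrow> b \<in> cuts k \<Longrightarrow> a \<noteq> b \<Longrightarrow> c0 \<le> slope (Suc k) * \<bar>a - b\<bar>"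
proof -
  obtain c0 where c0: "0 < c0" and sep: "\<And>\<delta> t k. t 0 = 0 \<Longrightarrow> (\<And>j. t (Suc j) = \<beta> * t j + of_int (\<delta> j)) \<Longrightarrow>
     (\<And>j. \<bar>\<delta> j\<bar> \<le> int q + 1) \<Longrightarrow> t k \<noteq> 0 \<Longrightarrow> c0 \<le> \<bar>t k\<bar>" using separation by blast
  have "c0 \<le> slope (Suc k) * \<bar>a - b\<bar>" if ab: "a \<in> cuts k" "b \<in> cuts k" "a \<noteq> b" for k a b
  proof -
    define n where "n x j = \<lfloor>\<beta> * (T \<beta> x ^^ j) 1 + x\<rfloor>" for x j
    define t where "t j = ((T \<beta> a ^^ j) 1 - slope j * a) - ((T \<beta> b ^^ j) 1 - slope j * b)" for j
    have T1: "(T \<beta> x ^^ Suc j) 1 = \<beta> * (T \<beta> x ^^ j) 1 + x - of_int (n x j)" for x j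
      by (simp add: T_def n_def)
    have n: "0 \<le> n x j" "n x j \<le> int q + 1" if "0 \<le> x" "x < 1" for x j
      unfolding n_def by (intro floor_range that orbit_bounds)+
    have tk: "t (Suc k) = - (slope (Suc k) * (a - b))"
      using ab by (simp add: t_def cuts_def algebra_simps)
    have spos: "0 < slope (Suc k)" using slope_ge[of "Suc k"] by simp
    have "c0 \<le> \<bar>t (Suc k)\<bar>"
    proof (rule sep[of t "\<lambda>j. n b j - n a j"])
      show "t 0 = 0" by (simp add: t_def slope_0)
      show "t (Suc j) = \<beta> * t j + of_int (n b j - n a j)" for j
        unfolding t_def T1 slope_Suc by (simp add: algebra_simps)
      show "\<bar>n b j - n a j\<bar> \<le> int q + 1" for j
        using n[of a j] n[of b j] ab by (auto simp: cuts_def)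
      show "t (Suc k) \<noteq> 0" using tk ab spos by simp
    qed
    then show ?thesis using tk spos by (simp add: abs_mult)
  qed
  then show ?thesis using that c0 by blast
qed

end

lemma card_separated:
  fixes S :: "real set"
  assumes S: "S \<subseteq> {0..<1}" and s: "0 < s" and sep: "\<And>a b. a \<in> S \<Longrightarrow> b \<in> S \<Longrightarrow> a \<noteq> b \<Longrightarrow> s \<le> \<bar>a - b\<bar>"
  shows "finite S" "real (card S) \<le> 1 / s + 1"
proof -
  define f where "f x = \<lfloor>x / s\<rfloor>" for x :: real
  have inj: "inj_on f S"
  proof (rule inj_onI, rule ccontr)
    fix a b assume ab: "a \<in> S" "b \<in> S" "f a = f b" "a \<noteq> b"
    then have "\<bar>a / s - b / s\<bar> < 1" unfolding f_def by linarith
    then have "\<bar>a - b\<bar> / s < 1" using s by (simp add: diff_divide_distrib[symmetric])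
    then have "\<bar>a - b\<bar> < s" using s by (simp add: divide_less_eq)
    then show False using sep[of a b] ab by simp
  qed
  have im: "f ` S \<subseteq> {0..\<lfloor>1 / s\<rfloor>}"
  proof
    fix v assume "v \<in> f ` S"
    then obtain x where x: "x \<in> S" "v = f x" by blast
    then have "0 \<le> x / s" "x / s \<le> 1 / s" using S s by (auto intro!: divide_right_mono)
    then show "v \<in> {0..\<lfloor>1 / s\<rfloor>}" unfolding x f_def by (auto intro: floor_mono)
  qed
  show "finite S" using inj_on_finite[OF inj im] by simp
  have "card S \<le> card {0..\<lfloor>1 / s\<rfloor>}" by (rule card_inj_on_le[OF inj im]) simp
  moreover have "0 \<le> \<lfloor>1 / s\<rfloor> + 1" using s by simp
  ultimately have "int (card S) \<le> \<lfloor>1 / s\<rfloor> + 1" by (simp add: le_nat_iff)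
  then show "real (card S) \<le> 1 / s + 1" by linarith
qed

context multinacci_base
begin

text \<open>
  By the intermediate value principle, the integer part in the definition of \<open>T\<close> can change only at a
  breakpoint.
\<close>

lemma orbit_affine:
  assumes I: "0 \<le> a" "b \<le> 1" and free: "\<And>j x. j < k \<Longrightarrow> a < x \<Longrightarrow> x < b \<Longrightarrow> x \<notin> cuts j"
    and xy: "a < x" "x < b" "a < y" "y < b"
  shows "(T \<beta> x ^^ k) 1 - (T \<beta> y ^^ k) 1 = slope k * (x - y)"
  using free xy
proof (induction k arbitrary: x y)
  case 0 then show ?case by (simp add: slope_0)
next
  case (Suc k)
  define f where "f u = \<beta> * (T \<beta> u ^^ k) 1 + u" for u
  have aff: "f v - f u = slope (Suc k) * (v - u)" if "a < u" "u < b" "a < v" "v < b" for u v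
  proof -
    have "(T \<beta> v ^^ k) 1 - (T \<beta> u ^^ k) 1 = slope k * (v - u)"
      by (rule Suc.IH) (use Suc.prems(1) that in auto)
    then have "\<beta> * ((T \<beta> v ^^ k) 1 - (T \<beta> u ^^ k) 1) = \<beta> * (slope k * (v - u))" by simp
    then show ?thesis by (simp add: f_def slope_Suc algebra_simps)
  qed
  have notint: "f u \<notin> \<int>" if "a < u" "u < b" for u
    using Suc.prems(1)[of k u] cuts_iff[of u k] that I by (simp add: f_def)
  have spos: "0 < slope (Suc k)" using slope_ge[of "Suc k"] by simp
  have le: "\<lfloor>f v\<rfloor> \<le> \<lfloor>f u\<rfloor>" if uv: "a < u" "u < v" "v < b" for u v
  proof (rule ccontr)
    assume "\<not> ?thesis"
    then have n: "of_int (\<lfloor>f u\<rfloor> + 1) \<le> f v" by linarith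
    have n2: "f u < of_int (\<lfloor>f u\<rfloor> + 1)" by linarith
    define w where "w = u + (of_int (\<lfloor>f u\<rfloor> + 1) - f u) / slope (Suc k)"
    have "of_int (\<lfloor>f u\<rfloor> + 1) - f u \<le> slope (Suc k) * (v - u)" using aff[of u v] uv n by simp
    then have "(of_int (\<lfloor>f u\<rfloor> + 1) - f u) / slope (Suc k) \<le> v - u"
      using spos by (simp add: divide_le_eq mult.commute)
    moreover have "0 < (of_int (\<lfloor>f u\<rfloor> + 1) - f u) / slope (Suc k)" using n2 spos by simp
    ultimately have w: "a < w" "w < b" using uv by (auto simp: w_def)
    have "f w - f u = slope (Suc k) * (w - u)" by (rule aff) (use uv w in auto)
    also have "\<dots> = of_int (\<lfloor>f u\<rfloor> + 1) - f u" using spos by (simp add: w_def)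
    finally have "f w = of_int (\<lfloor>f u\<rfloor> + 1)" by simp
    then show False using notint[OF w] by (metis Ints_of_int)
  qed
  have fl: "\<lfloor>f u\<rfloor> = \<lfloor>f v\<rfloor>" if uv: "a < u" "u < v" "v < b" for u v
  proof -
    have "0 \<le> slope (Suc k) * (v - u)" using uv spos by simp
    then have "f u \<le> f v" using aff[of u v] uv by simp
    then show ?thesis using le[OF uv] floor_mono[of "f u" "f v"] by simp
  qed
  have "\<lfloor>f x\<rfloor> = \<lfloor>f y\<rfloor>"
  proof (cases x y rule: linorder_cases)
    case less
    then show ?thesis by (intro fl Suc.prems)
  next
    case greater
    then show ?thesis by (intro fl[symmetric] Suc.prems)
  qed simp
  moreover have "(T \<beta> u ^^ Suc k) 1 = f u - of_int \<lfloor>f u\<rfloor>" for u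
    unfolding f_def funpow.simps comp_apply by (rule T_def)
  ultimately show ?case using aff[of y x] Suc.prems(2-5) by simp
qed

definition near_cuts :: "real \<Rightarrow> nat \<Rightarrow> real set" where
  "near_cuts \<rho> k = (\<Union>j<k. \<Union>a\<in>cuts j. ball a (\<rho> / slope k))"

text \<open>
  There are at most \<open>O (slope (Suc j))\<close> breakpoints of level \<open>j\<close>, and the slopes up to level \<open>k\<close> add up to
  \<open>O (slope k)\<close>, uniformly in \<open>k\<close>.
\<close>

lemma near_cuts_small:
  obtains C where "0 < C"
    "\<And>\<rho> k. 0 < \<rho> \<Longrightarrow> near_cuts \<rho> k \<in> lmeasurable \<and> measure lebesgue (near_cuts \<rho> k) \<le> C * \<rho>"
proof -
  obtain c0 where c0: "0 < c0" and
    sep: "\<And>k a b. a \<in> cuts k \<Longrightarrow> b \<in> cuts k \<Longrightarrow> a \<noteq> b \<Longrightarrow> c0 \<le> slope (Suc k) * \<bar>a - b\<bar>"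
    using cuts_separated by blast
  have fin: "finite (cuts k)" and card: "real (card (cuts k)) \<le> (1 / c0 + 1) * slope (Suc k)" for k
  proof -
    have s: "1 \<le> slope (Suc k)" using slope_ge[of "Suc k"] by simp
    have *: "c0 / slope (Suc k) \<le> \<bar>a - b\<bar>" if "a \<in> cuts k" "b \<in> cuts k" "a \<noteq> b" for a b
      using sep[OF that] s by (simp add: divide_le_eq mult.commute)
    have sub: "cuts k \<subseteq> {0..<1}" by (auto simp: cuts_def)
    have pos: "0 < c0 / slope (Suc k)" using c0 s by simp
    show "finite (cuts k)" by (rule card_separated(1)[OF sub pos *])
    have "real (card (cuts k)) \<le> 1 / (c0 / slope (Suc k)) + 1" by (rule card_separated(2)[OF sub pos *])
    also have "\<dots> \<le> (1 / c0 + 1) * slope (Suc k)" using s by (simp add: distrib_right)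
    finally show "real (card (cuts k)) \<le> (1 / c0 + 1) * slope (Suc k)" .
  qed
  define C where "C = (1 / c0 + 1) * (\<beta> / (\<beta> - 1)) * 2"
  have "0 < C" using c0 beta_gt_1 unfolding C_def by (intro mult_pos_pos add_pos_pos divide_pos_pos) auto
  moreover have "near_cuts \<rho> k \<in> lmeasurable \<and> measure lebesgue (near_cuts \<rho> k) \<le> C * \<rho>" if \<rho>: "0 < \<rho>" for \<rho> k
  proof
    define r where "r = \<rho> / slope k"
    have r0: "0 \<le> r" using \<rho> slope_nonneg by (simp add: r_def)
    have eq: "near_cuts \<rho> k = (\<Union>j\<in>{..<k}. \<Union>a\<in>cuts j. ball a r)" by (simp add: near_cuts_def r_def)
    have m1: "(\<Union>a\<in>cuts j. ball a r) \<in> lmeasurable" for j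
      using fin by (intro fmeasurable.finite_UN) auto
    show "near_cuts \<rho> k \<in> lmeasurable" unfolding eq by (rule fmeasurable.finite_UN[OF _ m1]) simp
    have ball: "measure lebesgue (ball a r) = 2 * r" for a :: real
      using r0 by (simp add: ball_eq_greaterThanLessThan)
    have one: "measure lebesgue (\<Union>a\<in>cuts j. ball a r) \<le> (1 / c0 + 1) * slope (Suc j) * (2 * r)" for j
    proof -
      have "measure lebesgue (\<Union>a\<in>cuts j. ball a r) \<le> (\<Sum>a\<in>cuts j. measure lebesgue (ball a r))"
        by (rule measure_UNION_le[OF fin]) simp
      also have "\<dots> = real (card (cuts j)) * (2 * r)" by (simp add: ball)
      also have "\<dots> \<le> (1 / c0 + 1) * slope (Suc j) * (2 * r)" using card[of j] r0 by (intro mult_right_mono) auto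
      finally show ?thesis .
    qed
    have "measure lebesgue (near_cuts \<rho> k) \<le> (\<Sum>j<k. measure lebesgue (\<Union>a\<in>cuts j. ball a r))"
      unfolding eq by (rule measure_UNION_le[OF _ fmeasurableD[OF m1]]) simp
    also have "\<dots> \<le> (\<Sum>j<k. (1 / c0 + 1) * slope (Suc j) * (2 * r))" by (intro sum_mono one)
    also have "\<dots> = (1 / c0 + 1) * (2 * r) * (\<Sum>j<k. slope (Suc j))"
      unfolding sum_distrib_left by (intro sum.cong) auto
    also have "\<dots> \<le> (1 / c0 + 1) * (2 * r) * (\<beta> / (\<beta> - 1) * slope k)"
      using c0 r0 by (intro mult_left_mono sum_slope) auto
    also have "\<dots> = C * (r * slope k)" by (simp add: C_def)
    also have "\<dots> \<le> C * \<rho>"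
      using \<rho> \<open>0 < C\<close> by (intro mult_left_mono) (auto simp: r_def)
    finally show "measure lebesgue (near_cuts \<rho> k) \<le> C * \<rho>" .
  qed
  ultimately show ?thesis using that by blast
qed

text \<open>
  The increasing union over \<open>K\<close> inherits the bound \<open>C * \<rho>\<close>, and \<open>\<rho>\<close> is arbitrary.
\<close>

lemma eventually_near_cuts_negligible:
  "negligible {\<alpha>. \<forall>\<rho>>0. \<exists>K. \<forall>k\<ge>K. \<alpha> \<in> near_cuts \<rho> k}" (is "negligible ?Z")
proof -
  obtain C where C: "0 < C"
    "\<And>\<rho> k. 0 < \<rho> \<Longrightarrow> near_cuts \<rho> k \<in> lmeasurable \<and> measure lebesgue (near_cuts \<rho> k) \<le> C * \<rho>"
    using near_cuts_small by blast
  show ?thesis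
    unfolding negligible_outer_le
  proof (intro allI impI)
    fix e :: real assume e: "0 < e"
    \<comment> \<open>so that the bound \<open>C * \<rho>\<close> is \<open>e\<close>\<close>
    define \<rho> where "\<rho> = e / C"
    have \<rho>: "0 < \<rho>" "C * \<rho> = e" using e C by (auto simp: \<rho>_def)
    define L where "L K = (\<Inter>k\<in>{K..}. near_cuts \<rho> k)" for K :: nat
    have Lm: "L K \<in> lmeasurable" for K
      unfolding L_def using C(2)[OF \<rho>(1)] by (intro fmeasurable_INT[of _ K]) (auto simp: fmeasurableD)
    have Le: "measure lebesgue (L K) \<le> e" for K
    proof -
      have "measure lebesgue (L K) \<le> measure lebesgue (near_cuts \<rho> K)"
        using C(2)[OF \<rho>(1)] Lm by (intro measure_mono_fmeasurable) (auto simp: L_def fmeasurableD)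
      also have "\<dots> \<le> e" using C(2)[OF \<rho>(1), of K] \<rho>(2) by simp
      finally show ?thesis .
    qed
    have nest: "L K \<subseteq> L (Suc K)" for K by (auto simp: L_def)
    have U: "(\<Union>K. L K) \<in> lmeasurable" by (rule measurable_nested_Union[where S = L, OF Lm Le nest])
    have "measure lebesgue (\<Union>K. L K) \<le> e"
      by (rule LIMSEQ_le_const2[OF measure_nested_Union[where S = L, OF Lm Le nest]]) (use Le in auto)
    moreover have "?Z \<subseteq> (\<Union>K. L K)"
    proof
      fix x assume "x \<in> ?Z"
      then obtain K where "\<forall>k\<ge>K. x \<in> near_cuts \<rho> k" using \<rho>(1) by blast
      then have "x \<in> L K" by (simp add: L_def)
      then show "x \<in> (\<Union>K. L K)" by blast
    qed
    ultimately show "\<exists>V. ?Z \<subseteq> V \<and> V \<in> lmeasurable \<and> measure lebesgue V \<le> e" using U by blast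
  qed
qed

end

section \<open>Matching for almost every parameter\<close>

lemma countable_negligible: "countable S \<Longrightarrow> negligible (S :: real set)"
  unfolding negligible_iff_null_sets
  by (intro null_sets_completionI countable_imp_null_set_lborel)

context multinacci_base
begin

text \<open>
  The parameters for which an arc that starts at the fixed point or at a point of a loop ends exactly at
  \<open>1\<close> for some window.
\<close>

definition ties :: "real set" where
  "ties = {\<alpha>. (\<exists>w. ell w = (\<alpha> - eps) / (\<beta> - 1)) \<or>
     (\<exists>i w. ell w = (\<alpha> - eps) / (\<beta> - 1) + real q / \<beta> ^ Suc i)}"

lemma countable_ties: "countable ties"
proof -
  let ?A = "(\<lambda>v. eps + (\<beta> - 1) * v) ` range ell"
  let ?B = "(\<lambda>(v, i). eps + (\<beta> - 1) * (v - real q / \<beta> ^ Suc i)) ` (range ell \<times> (UNIV :: nat set))"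
  have "ties \<subseteq> ?A \<union> ?B"
  proof
    fix x assume "x \<in> ties"
    then consider w where "ell w = (x - eps) / (\<beta> - 1)"
      | i w where "ell w = (x - eps) / (\<beta> - 1) + real q / \<beta> ^ Suc i" by (auto simp: ties_def)
    then show "x \<in> ?A \<union> ?B"
    proof cases
      case 1
      then have "x = eps + (\<beta> - 1) * ell w" using beta_gt_1 by simp
      then show ?thesis by blast
    next
      case (2 i w)
      then have "ell w - real q / \<beta> ^ Suc i = (x - eps) / (\<beta> - 1)" by simp
      then have "x = eps + (\<beta> - 1) * (ell w - real q / \<beta> ^ Suc i)" using beta_gt_1 by simp
      then show ?thesis by (intro UnI2 image_eqI[of _ _ "(ell w, i)"]) auto
    qed
  qed
  moreover have "countable (?A \<union> ?B)"
    by (intro countable_Un countable_image countable_SIGMA countable_finite[OF finite_range_ell] countableI_type)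
  ultimately show ?thesis by (rule countable_subset)
qed

lemma sync_pointE:
  assumes "sync_point \<alpha> h"
  obtains n \<delta> where "0 < \<delta>"
    "\<And>a x w. \<bar>a - \<alpha>\<bar> < \<delta> \<Longrightarrow> \<bar>x - h\<bar> < \<delta> \<Longrightarrow> const_window (win a n x w)"
proof -
  obtain n where "\<forall>\<^sub>F p in nhds \<alpha> \<times>\<^sub>F nhds h. \<forall>w. const_window (win (fst p) n (snd p) w)"
    using assms unfolding sync_point_def nhds_prod[symmetric] by blast
  then obtain P Q where PQ: "eventually P (nhds \<alpha>)" "eventually Q (nhds h)"
    "\<And>a x. P a \<Longrightarrow> Q x \<Longrightarrow> \<forall>w. const_window (win a n x w)"
    unfolding eventually_prod_filter by auto
  obtain d1 where d1: "0 < d1" "\<And>a. \<bar>a - \<alpha>\<bar> < d1 \<Longrightarrow> P a"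
    using PQ(1) unfolding eventually_nhds_metric dist_real_def by blast
  obtain d2 where d2: "0 < d2" "\<And>a. \<bar>a - h\<bar> < d2 \<Longrightarrow> Q a"
    using PQ(2) unfolding eventually_nhds_metric dist_real_def by blast
  show ?thesis
    by (rule that[of "min d1 d2" n]) (use d1 d2 PQ(3) in auto)
qed

definition porous_at :: "real \<Rightarrow> real \<Rightarrow> bool" where
  "porous_at c a \<longleftrightarrow> (\<forall>d>0. \<exists>r y. 0 < r \<and> r < d \<and> ball y (c * r) \<subseteq> ball a r \<and>
     (\<forall>x\<in>ball y (c * r). has_matching \<beta> x))"

text \<open>
  The unit interval is divided into \<open>M\<close> cells shorter than \<open>\<rho> / 2\<close>, and a synchronising point is fixed in
  each cell. For the infinitely many \<open>k\<close> without breakpoints near \<open>a\<close>, the cell that contains \<open>T ^ k 1\<close> is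
  covered by the values at parameters within \<open>r = \<rho> / slope k\<close> of \<open>a\<close>, so a proportion of them, independent
  of \<open>k\<close>, comes close to the point fixed there.
\<close>

lemma matching_porous:
  assumes al: "eps < a" "a < real q / \<beta>" and nt: "a \<notin> ties"
    and nc: "\<not> (\<forall>\<rho>>0. \<exists>K. \<forall>k\<ge>K. a \<in> near_cuts \<rho> k)"
  shows "\<exists>c>0. porous_at c a"
proof -
  define c where "c = (a - eps) / (\<beta> - 1)"
  interpret sync_setting q m \<beta> a c
    by unfold_locales (use al nt in \<open>auto simp: c_def ties_def\<close>)
  interpret gap_setting q m \<beta> a z "{h. sync_point a h}"
  proof unfold_locales
    show "\<exists>h\<in>{h. sync_point a h}. \<bar>h - z\<bar> < \<delta>" if "0 < \<delta>" for \<delta> using sync_point_near_z[OF that] by blast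
    show "h \<in> {h. sync_point a h}" if "0 < h" "h < 1" "\<beta> * h + a \<notin> \<int>" "T \<beta> a h \<in> {h. sync_point a h}" for h
      using sync_point_preimage[of a h] that by simp
  qed (use al fixed in auto)
  obtain \<rho> where \<rho>: "0 < \<rho>" "\<And>K. \<exists>k\<ge>K. a \<notin> near_cuts \<rho> k" using nc by blast
  obtain M :: nat where M: "2 / \<rho> < real M" using reals_Archimedean2 by blast
  have "0 < 2 / \<rho>" using \<rho> by simp
  then have M0: "0 < M" using M by (metis less_trans of_nat_0_less_iff)
  have invM: "1 / real M < \<rho> / 2" using M M0 \<rho>(1) by (simp add: field_simps)
  define cell_target where "cell_target i t \<longleftrightarrow> (case t of (h, n, \<delta>) \<Rightarrow>
      real i / M < h \<and> h < (real i + 1) / M \<and> 0 < \<delta> \<and>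
      (\<forall>x y w. \<bar>x - a\<bar> < \<delta> \<longrightarrow> \<bar>y - h\<bar> < \<delta> \<longrightarrow> const_window (win x n y w)))" for i t
  have "\<exists>t. cell_target i t" if "i < M" for i
  proof -
    have "(real i + 1) / M \<le> 1" "real i / M < (real i + 1) / M"
      using that M0 by (auto simp: divide_le_eq divide_strict_right_mono)
    then obtain h where h: "sync_point a h" "real i / M < h" "h < (real i + 1) / M"
      using dense[of "real i / M" "(real i + 1) / M"] by auto
    obtain n \<delta> where "0 < \<delta>" "\<And>x y w. \<bar>x - a\<bar> < \<delta> \<Longrightarrow> \<bar>y - h\<bar> < \<delta> \<Longrightarrow> const_window (win x n y w)"
      by (rule sync_pointE[OF h(1)], rule that)
    then have "cell_target i (h, n, \<delta>)" using h unfolding cell_target_def by blast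
    then show ?thesis ..
  qed
  then obtain f where f: "\<And>i. i < M \<Longrightarrow> cell_target i (f i)" by metis
  define h where "h i = fst (f i)" for i
  define n where "n i = fst (snd (f i))" for i
  define \<delta> where "\<delta> i = snd (snd (f i))" for i
  have H: "real i / M < h i \<and> h i < (real i + 1) / M \<and> 0 < \<delta> i \<and>
      (\<forall>x y w. \<bar>x - a\<bar> < \<delta> i \<longrightarrow> \<bar>y - h i\<bar> < \<delta> i \<longrightarrow> const_window (win x (n i) y w))" if "i < M" for i
    using f[OF that] unfolding cell_target_def h_def n_def \<delta>_def case_prod_beta .
  define \<delta>0 where "\<delta>0 = Min (\<delta> ` {..<M})"
  have \<delta>0: "0 < \<delta>0" unfolding \<delta>0_def using H M0 by (subst Min_gr_iff) auto
  have \<delta>le: "\<delta>0 \<le> \<delta> i" if "i < M" for i unfolding \<delta>0_def using that by (intro Min_le) auto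
  define C where "C = min (1 / 2) (\<delta>0 / \<rho>)"
  have C: "0 < C" "C \<le> 1 / 2" "C * \<rho> \<le> \<delta>0"
    using \<delta>0 \<rho>(1) by (auto simp: C_def min_def field_simps)
  have "porous_at C a"
    unfolding porous_at_def
  proof (intro allI impI)
    fix d :: real assume d: "0 < d"
    \<comment> \<open>\<open>r < e\<close> will keep the parameters within the unit interval and within \<open>\<delta>0\<close> of \<open>a\<close>\<close>
    define e where "e = min (min d \<delta>0) (min a (1 - a))"
    have e: "0 < e" using d \<delta>0 al01 by (simp add: e_def)
    obtain K :: nat where K: "\<rho> / e < real K" using reals_Archimedean2 by blast
    obtain k where k: "Suc K \<le> k" "a \<notin> near_cuts \<rho> k" using \<rho>(2) by blast
    define s where "s = slope k"
    have "real K < s" using slope_ge[of k] k(1) by (simp add: s_def)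
    then have s: "0 < s" "\<rho> / e < s" using K \<rho>(1) e by (auto intro: less_trans)
    define r where "r = \<rho> / s"
    have r: "0 < r" "r < e" using s \<rho>(1) e by (auto simp: r_def field_simps)
    have aff: "(T \<beta> x ^^ k) 1 - (T \<beta> a ^^ k) 1 = s * (x - a)" if "\<bar>x - a\<bar> < r" for x
      unfolding s_def
    proof (rule orbit_affine[of "a - r" "a + r"])
      show "0 \<le> a - r" "a + r \<le> 1" using r by (auto simp: e_def)
      show "x' \<notin> cuts j" if "j < k" "a - r < x'" "x' < a + r" for j x'
      proof
        assume "x' \<in> cuts j"
        moreover have "a \<in> ball x' (\<rho> / slope k)" using that by (auto simp: r_def s_def dist_real_def)
        ultimately show False using k(2) that(1) by (auto simp: near_cuts_def)
      qed
    qed (use that r in \<open>auto simp: abs_less_iff\<close>)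
    define l where "l = (T \<beta> a ^^ k) 1"
    obtain k' where k': "k = Suc k'" using k(1) by (cases k) auto
    have l: "0 \<le> l" "l < 1" unfolding l_def k' using T_in by auto
    define i where "i = nat \<lfloor>l * M\<rfloor>"
    have fl: "0 \<le> \<lfloor>l * M\<rfloor>" using l by simp
    have iM: "real i \<le> l * M" "l * M < real i + 1"
      using fl by (simp_all add: i_def)
    have "l * M < 1 * real M" using l M0 by (intro mult_strict_right_mono) auto
    then have "i < M" using iM by linarith
    note Hi = H[OF this]
    have "real i / M \<le> l" "l < (real i + 1) / M" using iM M0 by (auto simp: field_simps)
    then have "\<bar>h i - l\<bar> < (real i + 1) / M - real i / M" using Hi by linarith
    also have "\<dots> = 1 / real M" by (simp add: diff_divide_distrib[symmetric])
    finally have hl: "\<bar>h i - l\<bar> < \<rho> / 2" using invM by linarith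
    \<comment> \<open>the parameter at which the affine map takes the value \<open>h i\<close>\<close>
    define y where "y = a + (h i - l) / s"
    have "\<bar>y - a\<bar> = \<bar>h i - l\<bar> / s" using s by (simp add: y_def)
    also have "\<dots> < (\<rho> / 2) / s" using hl s by (intro divide_strict_right_mono) auto
    finally have ya: "\<bar>y - a\<bar> < r / 2" by (simp add: r_def)
    have Cr: "C * r \<le> r / 2" using C r mult_right_mono[of C "1 / 2" r] by simp
    have sub: "ball y (C * r) \<subseteq> ball a r"
    proof
      fix x assume "x \<in> ball y (C * r)"
      then have "\<bar>y - x\<bar> < r / 2" using Cr by (simp add: dist_real_def)
      moreover have "\<bar>a - x\<bar> \<le> \<bar>y - a\<bar> + \<bar>y - x\<bar>" by (simp add: abs_if)
      ultimately have "\<bar>a - x\<bar> < r" using ya by argo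
      then show "x \<in> ball a r" by (simp add: dist_real_def)
    qed
    have "has_matching \<beta> x" if x: "x \<in> ball y (C * r)" for x
    proof -
      have xa: "\<bar>x - a\<bar> < r" using subsetD[OF sub x] by (simp add: dist_real_def abs_minus_commute)
      have "\<bar>x - a\<bar> < \<delta> i" using xa r \<delta>le[OF \<open>i < M\<close>] by (simp add: e_def)
      moreover have "\<bar>(T \<beta> x ^^ k) 1 - h i\<bar> < \<delta> i"
      proof -
        have "s * (y - a) = h i - l" using s by (simp add: y_def)
        then have "(T \<beta> x ^^ k) 1 - h i = s * (x - y)"
          using aff[OF xa] by (simp add: l_def algebra_simps)
        then have "\<bar>(T \<beta> x ^^ k) 1 - h i\<bar> = s * \<bar>x - y\<bar>" using s by (simp add: abs_mult)
        also have "\<dots> < s * (C * r)" using x s by (intro mult_strict_left_mono) (auto simp: dist_real_def abs_minus_commute)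
        also have "\<dots> = C * \<rho>" using s by (simp add: r_def)
        finally show ?thesis using C(3) \<delta>le[OF \<open>i < M\<close>] by linarith
      qed
      ultimately have "const_window (win x (n i) ((T \<beta> x ^^ k) 1) w)" for w using Hi by blast
      moreover have "(T \<beta> x ^^ k) 1 = (T \<beta> x ^^ k') (T \<beta> x 1)" by (simp add: k' funpow_swap1)
      ultimately have "const_window (win x (n i + k') (T \<beta> x 1) first_window)"
        unfolding win_add by simp
      then show ?thesis by (rule matching_if_const)
    qed
    then show "\<exists>r y. 0 < r \<and> r < d \<and> ball y (C * r) \<subseteq> ball a r \<and> (\<forall>x\<in>ball y (C * r). has_matching \<beta> x)"
      using r sub by (intro exI[of _ r] exI[of _ y]) (auto simp: e_def)
  qed
  then show ?thesis using C(1) by blast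
qed

text \<open>
  The set without matching is split according to the porosity constant.
\<close>

lemma negligible_middle: "negligible {\<alpha>. eps < \<alpha> \<and> \<alpha> < real q / \<beta> \<and> \<not> has_matching \<beta> \<alpha>}"
proof -
  define Z where "Z = {\<alpha>. \<forall>\<rho>>0. \<exists>K. \<forall>k\<ge>K. \<alpha> \<in> near_cuts \<rho> k}"
  define S where "S N = {\<alpha>. eps < \<alpha> \<and> \<alpha> < real q / \<beta> \<and> \<not> has_matching \<beta> \<alpha> \<and> porous_at (1 / real (Suc N)) \<alpha>}"
    for N :: nat
  have "negligible (S N)" for N
  proof (rule porous_negligible_bounded[of "1 / real (Suc N)"])
    show "bounded (S N)"
      by (rule bounded_subset[OF bounded_closed_interval[of eps "real q / \<beta>"]]) (auto simp: S_def)
    show "\<exists>r y. 0 < r \<and> r < d \<and> ball y (1 / real (Suc N) * r) \<subseteq> ball x r \<and> ball y (1 / real (Suc N) * r) \<inter> S N = {}"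
      if xd: "x \<in> S N" "0 < d" for x d
    proof -
      have "porous_at (1 / real (Suc N)) x" using xd(1) by (simp only: S_def mem_Collect_eq)
      then obtain r y where *: "0 < r" "r < d" "ball y (1 / real (Suc N) * r) \<subseteq> ball x r"
        "\<forall>x\<in>ball y (1 / real (Suc N) * r). has_matching \<beta> x"
        unfolding porous_at_def using xd(2) by blast
      then have "ball y (1 / real (Suc N) * r) \<inter> S N = {}" unfolding S_def by blast
      then show ?thesis using * by blast
    qed
  qed simp
  then have "negligible (\<Union>N. S N)" by (intro negligible_countable_Union) auto
  then have neg: "negligible (ties \<union> Z \<union> (\<Union>N. S N))"
    using eventually_near_cuts_negligible countable_negligible[OF countable_ties]
    by (simp add: Z_def)
  show ?thesis
  proof (rule negligible_subset[OF neg], rule subsetI)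
    fix a assume a: "a \<in> {\<alpha>. eps < \<alpha> \<and> \<alpha> < real q / \<beta> \<and> \<not> has_matching \<beta> \<alpha>}"
    show "a \<in> ties \<union> Z \<union> (\<Union>N. S N)"
    proof (cases "a \<in> ties \<or> a \<in> Z")
      case False
      then obtain c where c: "0 < c" "porous_at c a"
        using matching_porous[of a] a by (auto simp: Z_def)
      obtain N where N: "1 / real (Suc N) < c" using nat_approx_posE[OF c(1)] by blast
      have "porous_at (1 / real (Suc N)) a"
        unfolding porous_at_def
      proof (intro allI impI)
        fix d :: real assume "0 < d"
        then obtain r y where *: "0 < r" "r < d" "ball y (c * r) \<subseteq> ball a r" "\<forall>x\<in>ball y (c * r). has_matching \<beta> x"
          using c(2) unfolding porous_at_def by blast
        have "1 / real (Suc N) * r \<le> c * r" using N *(1) by (intro mult_right_mono) auto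
        then have "ball y (1 / real (Suc N) * r) \<subseteq> ball y (c * r)" by (rule subset_ball)
        then show "\<exists>r y. 0 < r \<and> r < d \<and> ball y (1 / real (Suc N) * r) \<subseteq> ball a r \<and>
            (\<forall>x\<in>ball y (1 / real (Suc N) * r). has_matching \<beta> x)" using * by blast
      qed
      then show ?thesis using a by (auto simp: S_def)
    qed auto
  qed
qed

lemma slope_m: "slope m * eps = 1"
  using sum_lam by (simp add: slope_def lam_def sum_distrib_left mult.commute)

lemma slope_mono: "j \<le> k \<Longrightarrow> slope j \<le> slope k"
  unfolding slope_def using beta_pos by (intro sum_mono2) auto

text \<open>
  Before time \<open>m\<close> the orbit of \<open>0\<close> stays in the first branch and the orbit of \<open>1\<close> in the branch with number
  \<open>q\<close>; their distance \<open>1 - slope k * eps\<close> vanishes at \<open>k = m\<close>.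
\<close>

lemma matching_small:
  assumes "0 \<le> \<alpha>" "\<alpha> < eps" shows "has_matching \<beta> \<alpha>"
proof -
  have le: "slope k * eps \<le> 1" if "k \<le> m" for k
    using mult_right_mono[OF slope_mono[OF that], of eps] eps_pos slope_m by simp
  have "(T \<beta> \<alpha> ^^ k) 0 = slope k * \<alpha> \<and> (T \<beta> \<alpha> ^^ k) 1 = slope k * \<alpha> + 1 - slope k * eps" if "k \<le> m" for k
    using that
  proof (induction k)
    case 0 then show ?case by (simp add: slope_0)
  next
    case (Suc k)
    have p: "0 < slope (Suc k)" using slope_ge[of "Suc k"] by simp
    have u: "0 \<le> slope (Suc k) * \<alpha>" "slope (Suc k) * \<alpha> < slope (Suc k) * eps"
      using assms p by auto
    have l: "slope (Suc k) * eps \<le> 1" by (rule le[OF Suc.prems])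
    have IH: "(T \<beta> \<alpha> ^^ k) 0 = slope k * \<alpha>" "(T \<beta> \<alpha> ^^ k) 1 = slope k * \<alpha> + 1 - slope k * eps" using Suc by auto
    have "\<beta> * (slope k * \<alpha>) + \<alpha> = slope (Suc k) * \<alpha>" by (simp add: slope_Suc algebra_simps)
    then have "(T \<beta> \<alpha> ^^ Suc k) 0 = frac (slope (Suc k) * \<alpha>)" by (simp add: IH T_frac)
    also have "\<dots> = slope (Suc k) * \<alpha>" using u l by (simp add: frac_eq)
    finally have 0: "(T \<beta> \<alpha> ^^ Suc k) 0 = slope (Suc k) * \<alpha>" .
    have "\<beta> * (slope k * \<alpha> + 1 - slope k * eps) + \<alpha>
        = (slope (Suc k) * \<alpha> + 1 - slope (Suc k) * eps) + (\<beta> + eps - 1)"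
      by (simp add: slope_Suc algebra_simps)
    also have "\<beta> + eps - 1 = of_int (int q)" by (simp add: eps_def)
    finally have e: "\<beta> * (slope k * \<alpha> + 1 - slope k * eps) + \<alpha>
        = (slope (Suc k) * \<alpha> + 1 - slope (Suc k) * eps) + of_int (int q)" .
    have "(T \<beta> \<alpha> ^^ Suc k) 1 = frac (\<beta> * (slope k * \<alpha> + 1 - slope k * eps) + \<alpha>)" by (simp add: IH T_frac)
    also have "\<dots> = frac (slope (Suc k) * \<alpha> + 1 - slope (Suc k) * eps)"
      unfolding e by (rule frac_eq_if_diff_int) simp
    also have "\<dots> = slope (Suc k) * \<alpha> + 1 - slope (Suc k) * eps" using u l by (simp add: frac_eq)
    finally show ?case using 0 by simp
  qed
  from this[of m] have "(T \<beta> \<alpha> ^^ m) 0 = (T \<beta> \<alpha> ^^ m) 1" using slope_m by simp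
  then show ?thesis unfolding has_matching_def using m2 by (intro exI[of _ m]) auto
qed

text \<open>
  The fixed point \<open>z\<close> of the middle branch lies between \<open>T 1 = \<alpha> - eps\<close> and \<open>T 0 = \<alpha>\<close>. Both orbits are
  repelled from \<open>z\<close> inside the unit interval for \<open>m\<close> steps, and then have distance
  \<open>eps * \<beta> ^ (m - 1) = 1 / \<beta>\<close>, so that their images coincide. The bounds on \<open>\<alpha>\<close> are exactly those under
  which the orbits do not leave the interval.
\<close>

lemma matching_center:
  assumes q: "q = 1" and al: "1 / \<beta> < \<alpha>" "\<alpha> < 1 + eps - 1 / \<beta>"
  shows "has_matching \<beta> \<alpha>"
proof -
  define z where "z = (1 - \<alpha>) / (\<beta> - 1)"
  have eps: "eps = 2 - \<beta>" unfolding eps_def using q by simp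
  have zb: "(\<beta> - 1) * z = 1 - \<alpha>" using beta_gt_1 by (simp add: z_def)
  have b1: "0 < \<beta> - 1" using beta_gt_1 by simp
  have a1: "1 < \<beta> * \<alpha>" using al(1) beta_pos by (simp add: field_simps)
  have a2: "\<beta> * \<alpha> < \<beta> + \<beta> * eps - 1" using al(2) beta_pos by (simp add: field_simps)
  define u where "u = \<alpha> - z"
  \<comment> \<open>\<open>u\<close> and \<open>v\<close> are the distances of \<open>z\<close> to \<open>T 0\<close> and to \<open>T 1\<close>\<close>
  define v where "v = z - \<alpha> + eps"
  have ub: "(\<beta> - 1) * u = \<beta> * \<alpha> - 1" using zb by (simp add: u_def algebra_simps)
  have vb: "(\<beta> - 1) * v = 1 - \<beta> * \<alpha> + (\<beta> - 1) * eps" using zb by (simp add: v_def algebra_simps)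
  have u: "0 < u"
    using ub a1 b1 by (metis diff_gt_0_iff_gt zero_less_mult_pos)
  have "0 < (\<beta> - 1) * v" using vb a2 by (simp add: eps algebra_simps)
  then have v: "0 < v" using b1 by (metis zero_less_mult_pos)
  have "(\<beta> - 1) * u < (\<beta> - 1) * (\<beta> * eps * (1 - z))"
  proof -
    have "(\<beta> - 1) * (\<beta> * eps * (1 - z)) = \<beta> * eps * ((\<beta> - 1) - (\<beta> - 1) * z)" by (simp add: algebra_simps)
    also have "\<dots> = \<beta> * eps * (\<alpha> - eps)" unfolding zb by (simp add: eps)
    finally have R: "(\<beta> - 1) * (\<beta> * eps * (1 - z)) = \<beta> * eps * (\<alpha> - eps)" .
    have "\<beta> * \<alpha> * (\<beta> - 1) < (\<beta> + \<beta> * eps - 1) * (\<beta> - 1)"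
      using a2 b1 by (intro mult_strict_right_mono) auto
    also have "\<dots> = 1 - \<beta> * eps * eps" unfolding eps by (simp add: algebra_simps)
    finally have "\<beta> * \<alpha> - 1 < \<beta> * eps * (\<alpha> - eps)" unfolding eps by (simp add: algebra_simps)
    then show ?thesis unfolding ub R .
  qed
  then have ul: "u < \<beta> * eps * (1 - z)" by (rule mult_left_less_imp_less) (use b1 in simp)
  have "(\<beta> - 1) * v \<le> (\<beta> - 1) * (\<beta> * eps * z)"
  proof -
    have R: "(\<beta> - 1) * (\<beta> * eps * z) = \<beta> * eps * (1 - \<alpha>)" unfolding zb[symmetric] by (simp add: algebra_simps)
    have "1 * (\<beta> - 1) \<le> (\<beta> * \<alpha>) * (\<beta> - 1)" using a1 b1 by (intro mult_right_mono) auto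
    then show ?thesis unfolding vb R by (simp add: eps algebra_simps)
  qed
  then have vl: "v \<le> \<beta> * eps * z" by (rule mult_left_le_imp_le) (use b1 in simp)
  have bm: "\<beta> ^ (m - 1) * (\<beta> * eps) = 1"
    using beta_lam_last unfolding lam_def using q by (simp add: mult_ac)
  have pw: "\<beta> ^ k \<le> \<beta> ^ (m - 1)" if "k < m" for k using beta_gt_1 that by (intro power_increasing) auto
  have hi: "z + \<beta> ^ k * u < 1" if "k < m" for k
  proof -
    have "\<beta> ^ k * u \<le> \<beta> ^ (m - 1) * u" using pw[OF that] u by (intro mult_right_mono) auto
    also have "\<dots> < \<beta> ^ (m - 1) * (\<beta> * eps * (1 - z))" using ul beta_pos by (intro mult_strict_left_mono) auto
    also have "\<dots> = 1 - z" using bm by (metis mult.assoc mult_1)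
    finally show ?thesis by simp
  qed
  have lo: "0 \<le> z - \<beta> ^ k * v" if "k < m" for k
  proof -
    have "\<beta> ^ k * v \<le> \<beta> ^ (m - 1) * v" using pw[OF that] v by (intro mult_right_mono) auto
    also have "\<dots> \<le> \<beta> ^ (m - 1) * (\<beta> * eps * z)" using vl beta_pos by (intro mult_left_mono) auto
    also have "\<dots> = z" using bm by (metis mult.assoc mult_1)
    finally show ?thesis by simp
  qed
  have pk: "0 < \<beta> ^ k * u" "0 < \<beta> ^ k * v" for k using beta_pos u v by auto
  have Tz: "T \<beta> \<alpha> (z + y) = z + \<beta> * y" if "0 \<le> z + \<beta> * y" "z + \<beta> * y < 1" for y
  proof -
    have "\<beta> * (z + y) + \<alpha> = z + \<beta> * y + of_int 1" using zb by (simp add: algebra_simps)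
    then have "T \<beta> \<alpha> (z + y) = frac (z + \<beta> * y)"
      unfolding T_frac by (intro frac_eq_if_diff_int) simp
    then show ?thesis using that by (simp add: frac_eq)
  qed
  have m0: "0 < m" using m2 by simp
  have orb: "(T \<beta> \<alpha> ^^ Suc k) 0 = z + \<beta> ^ k * u \<and> (T \<beta> \<alpha> ^^ Suc k) 1 = z - \<beta> ^ k * v" if "k < m" for k
    using that
  proof (induction k)
    case 0
    have "\<alpha> < 1" "0 \<le> \<alpha>" "0 \<le> \<alpha> - eps" "\<alpha> - eps < 1"
      using hi[OF m0] lo[OF m0] pk[of 0] eps_pos by (auto simp: u_def v_def)
    then have "frac \<alpha> = \<alpha>" "frac (\<alpha> - eps) = \<alpha> - eps" by (simp_all add: frac_eq)
    moreover have "frac (\<beta> + \<alpha>) = frac (\<alpha> - eps)"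
      by (rule frac_eq_if_diff_int) (simp add: eps)
    ultimately show ?case by (simp add: T_frac u_def v_def)
  next
    case (Suc k)
    then have IH: "(T \<beta> \<alpha> ^^ Suc k) 0 = z + \<beta> ^ k * u" "(T \<beta> \<alpha> ^^ Suc k) 1 = z + (- (\<beta> ^ k * v))" by auto
    have z: "0 \<le> z" "z < 1" using hi[OF m0] lo[OF m0] pk[of 0] by auto
    have "T \<beta> \<alpha> (z + \<beta> ^ k * u) = z + \<beta> ^ Suc k * u"
      using Tz[of "\<beta> ^ k * u"] hi[OF Suc.prems] pk(1)[of "Suc k"] z by (simp add: mult.assoc)
    moreover have "T \<beta> \<alpha> (z + (- (\<beta> ^ k * v))) = z - \<beta> ^ Suc k * v"
      using Tz[of "- (\<beta> ^ k * v)"] lo[OF Suc.prems] pk(2)[of "Suc k"] z by (simp add: mult.assoc)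
    ultimately show ?case unfolding funpow.simps(2)[of "Suc k"] comp_apply IH by blast
  qed
  have mS: "m = Suc (m - 1)" using m2 by simp
  have e: "(T \<beta> \<alpha> ^^ m) 0 = z + \<beta> ^ (m - 1) * u" "(T \<beta> \<alpha> ^^ m) 1 = z - \<beta> ^ (m - 1) * v"
    using orb[of "m - 1"] mS by auto
  have "\<beta> * (z + \<beta> ^ (m - 1) * u) + \<alpha> - (\<beta> * (z - \<beta> ^ (m - 1) * v) + \<alpha>) = \<beta> ^ (m - 1) * (\<beta> * (u + v))"
    by (simp add: algebra_simps)
  also have "\<dots> = 1" using bm by (simp add: u_def v_def)
  finally have "T \<beta> \<alpha> ((T \<beta> \<alpha> ^^ m) 0) = T \<beta> \<alpha> ((T \<beta> \<alpha> ^^ m) 1)"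
    unfolding e T_frac by (intro frac_eq_if_diff_int) simp
  then have e: "(T \<beta> \<alpha> ^^ Suc m) 0 = (T \<beta> \<alpha> ^^ Suc m) 1" by simp
  show ?thesis
    unfolding has_matching_def by (rule exI[of _ "Suc m"], rule conjI, simp, rule e)
qed

text \<open>
  For fixed \<open>k\<close> the number \<open>T ^ k x - slope k * \<alpha>\<close> has only countably many possible values.
\<close>

lemma countable_orbit_zero: "countable {\<alpha>. (T \<beta> \<alpha> ^^ Suc k) x = 0}"
proof -
  have "\<exists>C. countable C \<and> (\<forall>\<alpha>. (T \<beta> \<alpha> ^^ k) x - slope k * \<alpha> \<in> C)" for k
  proof (induction k)
    case 0 show ?case by (intro exI[of _ "{x}"]) (simp add: slope_0)
  next
    case (Suc k)
    then obtain C where C: "countable C" "\<And>\<alpha>. (T \<beta> \<alpha> ^^ k) x - slope k * \<alpha> \<in> C" by blast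
    define D where "D = (\<lambda>(p, n :: int). \<beta> * p - of_int n) ` (C \<times> UNIV)"
    have "countable D" unfolding D_def using C by (intro countable_image countable_SIGMA countableI_type)
    moreover have "(T \<beta> \<alpha> ^^ Suc k) x - slope (Suc k) * \<alpha> \<in> D" for \<alpha>
      unfolding D_def
    proof (rule image_eqI)
      show "(T \<beta> \<alpha> ^^ Suc k) x - slope (Suc k) * \<alpha> = (\<lambda>(p, n :: int). \<beta> * p - of_int n)
          ((T \<beta> \<alpha> ^^ k) x - slope k * \<alpha>, \<lfloor>\<beta> * (T \<beta> \<alpha> ^^ k) x + \<alpha>\<rfloor>)"
        by (simp add: T_def[of _ _ "(T \<beta> \<alpha> ^^ k) x"] slope_Suc algebra_simps)
    qed (use C in simp)
    ultimately show ?case by blast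
  qed
  from this[of "Suc k"] obtain C where C: "countable C" "\<And>\<alpha>. (T \<beta> \<alpha> ^^ Suc k) x - slope (Suc k) * \<alpha> \<in> C" by blast
  have s: "0 < slope (Suc k)" using slope_ge[of "Suc k"] by simp
  have "{\<alpha>. (T \<beta> \<alpha> ^^ Suc k) x = 0} \<subseteq> (\<lambda>p. - p / slope (Suc k)) ` C"
  proof
    fix \<alpha> assume "\<alpha> \<in> {\<alpha>. (T \<beta> \<alpha> ^^ Suc k) x = 0}"
    then have "- (slope (Suc k) * \<alpha>) \<in> C" using C(2)[of \<alpha>] by simp
    then show "\<alpha> \<in> (\<lambda>p. - p / slope (Suc k)) ` C" by (rule rev_image_eqI) (use s in simp)
  qed
  then show ?thesis by (rule countable_subset) (use C in simp)
qed

lemma reflection: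
  assumes "\<And>k. (T \<beta> \<alpha> ^^ Suc k) x \<noteq> 0"
  shows "(T \<beta> (1 + eps - \<alpha>) ^^ k) (1 - x) = 1 - (T \<beta> \<alpha> ^^ k) x"
proof (induction k)
  case (Suc k)
  let ?y = "(T \<beta> \<alpha> ^^ k) x"
  have "frac (\<beta> * ?y + \<alpha>) \<noteq> 0" using assms[of k] by (simp add: T_frac)
  then have ni: "\<beta> * ?y + \<alpha> \<notin> \<int>" by (simp add: frac_eq_0_iff)
  have "(T \<beta> (1 + eps - \<alpha>) ^^ Suc k) (1 - x) = frac (\<beta> * (1 - ?y) + (1 + eps - \<alpha>))"
    unfolding funpow.simps(2) comp_apply Suc T_frac ..
  also have "\<dots> = frac (- (\<beta> * ?y + \<alpha>))"
  proof (rule frac_eq_if_diff_int)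
    have "\<beta> * (1 - ?y) + (1 + eps - \<alpha>) - - (\<beta> * ?y + \<alpha>) = of_int (int q + 2)"
      by (simp add: eps_def algebra_simps)
    then show "\<beta> * (1 - ?y) + (1 + eps - \<alpha>) - - (\<beta> * ?y + \<alpha>) \<in> \<int>" by (simp only: Ints_of_int)
  qed
  also have "\<dots> = 1 - frac (\<beta> * ?y + \<alpha>)" using ni by (simp only: frac_neg if_False)
  also have "frac (\<beta> * ?y + \<alpha>) = (T \<beta> \<alpha> ^^ Suc k) x" unfolding funpow.simps(2) comp_apply T_frac ..
  finally show ?case .
qed simp

lemma matching_reflection:
  assumes "has_matching \<beta> \<alpha>" "\<And>k. (T \<beta> \<alpha> ^^ Suc k) 0 \<noteq> 0" "\<And>k. (T \<beta> \<alpha> ^^ Suc k) 1 \<noteq> 0"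
  shows "has_matching \<beta> (1 + eps - \<alpha>)"
proof -
  obtain k where k: "1 \<le> k" "(T \<beta> \<alpha> ^^ k) 0 = (T \<beta> \<alpha> ^^ k) 1" using assms(1) by (auto simp: has_matching_def)
  have "(T \<beta> (1 + eps - \<alpha>) ^^ k) 1 = (T \<beta> (1 + eps - \<alpha>) ^^ k) 0"
    using reflection[OF assms(2), of k] reflection[OF assms(3), of k] k(2) by simp
  then show ?thesis using k(1) by (auto simp: has_matching_def)
qed

lemma negligible_upper:
  "negligible {\<alpha>. 1 + eps - real q / \<beta> < \<alpha> \<and> \<alpha> < 1 \<and> \<not> has_matching \<beta> \<alpha>}"
proof -
  define N where "N = {\<alpha>. eps < \<alpha> \<and> \<alpha> < real q / \<beta> \<and> \<not> has_matching \<beta> \<alpha>}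
     \<union> (\<Union>k. {\<alpha>. (T \<beta> \<alpha> ^^ Suc k) 0 = 0}) \<union> (\<Union>k. {\<alpha>. (T \<beta> \<alpha> ^^ Suc k) 1 = 0})"
  have "negligible N"
    unfolding N_def
    by (intro negligible_Un negligible_middle countable_negligible countable_UN countable_orbit_zero countableI_type)
  then have "negligible ((\<lambda>x. 1 + eps - x) ` N)"
    by (rule negligible_differentiable_image_negligible[OF order_refl])
      (intro derivative_intros differentiable_on_diff differentiable_on_const differentiable_on_ident)
  then show ?thesis
  proof (rule negligible_subset, intro subsetI)
    fix b assume b: "b \<in> {\<alpha>. 1 + eps - real q / \<beta> < \<alpha> \<and> \<alpha> < 1 \<and> \<not> has_matching \<beta> \<alpha>}"
    define a where "a = 1 + eps - b"
    have ba: "b = 1 + eps - a" by (simp add: a_def)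
    have "eps < a" "a < real q / \<beta>" using b by (auto simp: a_def)
    moreover have "\<not> has_matching \<beta> (1 + eps - a)" using b ba by simp
    ultimately have "a \<in> N" using matching_reflection[of a] by (auto simp: N_def)
    then show "b \<in> (\<lambda>x. 1 + eps - x) ` N" using ba by blast
  qed
qed

text \<open>
  For \<open>q \<ge> 2\<close> the intervals below \<open>q / \<beta>\<close> and above \<open>1 + eps - q / \<beta>\<close> cover everything up to
  finitely many points; for \<open>q = 1\<close> they leave out the central interval.
\<close>

lemma negligible_nonmatching: "negligible {\<alpha>. 0 \<le> \<alpha> \<and> \<alpha> < 1 \<and> \<not> has_matching \<beta> \<alpha>}"
proof -
  have "negligible ({\<alpha>. eps < \<alpha> \<and> \<alpha> < real q / \<beta> \<and> \<not> has_matching \<beta> \<alpha>}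
     \<union> {\<alpha>. 1 + eps - real q / \<beta> < \<alpha> \<and> \<alpha> < 1 \<and> \<not> has_matching \<beta> \<alpha>}
     \<union> {eps, real q / \<beta>, 1 + eps - real q / \<beta>})"
    by (intro negligible_Un negligible_middle negligible_upper negligible_finite) auto
  then show ?thesis
  proof (rule negligible_subset, intro subsetI)
    fix a assume "a \<in> {\<alpha>. 0 \<le> \<alpha> \<and> \<alpha> < 1 \<and> \<not> has_matching \<beta> \<alpha>}"
    then have a: "0 \<le> a" "a < 1" "\<not> has_matching \<beta> a" by auto
    have "\<not> a < eps" using matching_small a by blast
    moreover have False if "real q / \<beta> < a" "a < 1 + eps - real q / \<beta>"
    proof (cases "q = 1")
      case True
      then show False using matching_center[of a] that a by simp
    next
      case False
      then have q2: "2 \<le> real q" using q1 by simp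
      have "real q \<le> \<beta> * (\<beta> - real q)" using beta_square_ge by (simp add: power2_eq_square algebra_simps)
      then have "\<beta> + \<beta> * eps \<le> \<beta> + (\<beta> - real q)" by (simp add: eps_def algebra_simps)
      also have "\<dots> \<le> 2 * real q" using beta_lt q2 by simp
      finally have "1 + eps \<le> 2 * real q / \<beta>" using beta_pos by (simp add: pos_le_divide_eq algebra_simps)
      then have "1 + eps - real q / \<beta> \<le> real q / \<beta>" by simp
      then show False using that by simp
    qed
    ultimately show "a \<in> {\<alpha>. eps < \<alpha> \<and> \<alpha> < real q / \<beta> \<and> \<not> has_matching \<beta> \<alpha>}
     \<union> {\<alpha>. 1 + eps - real q / \<beta> < \<alpha> \<and> \<alpha> < 1 \<and> \<not> has_matching \<beta> \<alpha>}
     \<union> {eps, real q / \<beta>, 1 + eps - real q / \<beta>}" using a by fastforce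
  qed
qed

end

theorem theorem1p4:
  fixes q m :: nat
  assumes "m \<ge> 1" and "q \<ge> 1"
  shows "AE \<alpha> in lebesgue. \<alpha> \<in> {0..<1} \<longrightarrow> has_matching (multinacci q m) \<alpha>"
proof -
  have root: "is_multinacci q m (multinacci q m)"
    by (rule is_multinacci_multinacci) (use assms in auto)
  have neg: "negligible {\<alpha>. 0 \<le> \<alpha> \<and> \<alpha> < 1 \<and> \<not> has_matching (multinacci q m) \<alpha>}"
  proof (cases "m = 1")
    case True
    have "multinacci q m = of_int (int q)" using root True by (simp add: is_multinacci_def)
    then have "T (multinacci q m) \<alpha> 0 = T (multinacci q m) \<alpha> 1" for \<alpha>
      unfolding T_def by simp
    then have "has_matching (multinacci q m) \<alpha>" for \<alpha>
      unfolding has_matching_def by (intro exI[of _ 1]) simp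
    then show ?thesis by simp
  next
    case False
    interpret multinacci_base q m "multinacci q m"
      by unfold_locales (use False assms root in auto)
    show ?thesis by (rule negligible_nonmatching)
  qed
  show ?thesis
    by (rule AE_I'[OF neg[unfolded negligible_iff_null_sets]]) auto
qed

end
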